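(* Let $\widehat\beta_n$ be the penalized estimator described in the context, where $\rho$ satisfies (R3): $\rho$ is twice continuously differentiable with $\psi=\rho'$ and $\psi'=\rho''$ bounded. Assume that $\widehat\beta_n\to\beta_0$ in probability and that: (H2) $w$ is a non-negative bounded function, with $\|w\|_\infty=1$, whose support $\mathcal{C}_w=\{x:w(x)>0\}$ satisfies $\mathbb{P}(x\in\mathcal{C}_w)>0$; (H3) $\mathbb{E}[w(x)\|x\|^2]<\infty$; (H4) the matrix $A=\mathbb{E}\big(F(x^{T}\beta_0)[1-F(x^{T}\beta_0)]\,\nu(x^{T}\beta_0)\,w(x)\,x x^{T}\big)$ is non-singular. (a) Assume (P1): there exist $\epsilon>0$ and a constant $K$, not depending on $\lambda$, such that $|I_\lambda(\beta_1)-I_\lambda(\beta_2)|\le\lambda K\|\beta_1-\beta_2\|_1$ for all $\beta_1,\beta_2$ with $\|\beta_j-\beta_0\|_2\le\epsilon$, $j=1,2$. Then $\|\widehat\beta_n-\beta_0\|_2=O_{\mathbb{P}}(\lambda_n+1/\sqrt n)$. Hence, if $\lambda_n=O_{\mathbb{P}}(1/\sqrt n)$ then $\|\widehat\beta_n-\beta_0\|_2=O_{\mathbb{P}}(1/\sqrt n)$, while if $\lambda_n\sqrt n\to\infty$ then $\|\widehat\beta_n-\beta_0\|_2=O_{\mathbb{P}}(\lambda_n)$. (b) Suppose $I_{\lambda_n}(\beta)=\sum_{\ell=1}^pJ_{\lambda_n}(|\beta_\ell|)$, where $J_{\lambda_n}$ is two times differentiable in $(0,\infty)$, takes non-negative values,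 $J'_{\lambda_n}(|\beta_{0,\ell}|)\ge0$ (for $\ell$ with $\beta_{0,\ell}\neq 0$) and $J_{\lambda_n}(0)=0$. Let $$a_n=\max\{J'_{\lambda_n}(|\beta_{0,\ell}|):1\le\ell\le p,\ \beta_{0,\ell}\ne0\},\qquad \alpha_n=\frac1{\sqrt n}+a_n .$$ Assume in addition that there exists $\delta>0$ (small enough that the following expression is defined) such that $$\sup\{|J''_{\lambda_n}(|\beta_{0,\ell}|+\tau\delta)|:\tau\in[-1,1],\ 1\le\ell\le p,\ \beta_{0,\ell}\ne0\}\to0\quad\text{in probability.}$$ Then $\|\widehat\beta_n-\beta_0\|_2=O_{\mathbb{P}}(\alpha_n)$.
   Context: Model: $p\ge1$ is fixed; $(y_i,x_i)$, $i\ge 1$, are i.i.d. copies of $(y,x)$ with $x\in\mathbb{R}^p$, $y\in\{0,1\}$ and $\mathbb{P}(y=1\mid x)=F(x^{T}\beta_0)$, where $F(t)=e^t/(1+e^t)$ and $\beta_0\in\mathbb{R}^p$. Loss: $\rho:[0,\infty)\to\mathbb{R}$ is a bounded, differentiable, nondecreasing function with derivative $\psi=\rho'$, and $$\phi(y,t)=y\,\rho(-\log F(t))+(1-y)\,\rho(-\log(1-F(t)))+G(F(t))+G(1-F(t)),\qquad G(t)=\int_0^t\psi(-\log u)\,du .$$ Also $\nu(t)=\psi(-\log F(t))[1-F(t)]+\psi(-\log[1-F(t)])F(t)$. Weight: $w:\mathbb{R}^p\to[0,\infty)$ measurable. Penalty: for each tuning parameter $\lambda>0$, $I_\lambda:\mathbb{R}^p\to[0,\infty)$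 is a penalty function; $\lambda_n>0$ is a (deterministic or random) sequence. Estimator: $L_n(\beta)=\frac1n\sum_{i=1}^n\phi(y_i,x_i^{T}\beta)\,w(x_i)$ and $\widehat\beta_n$ is a minimizer, $\widehat\beta_n=\operatorname{argmin}_{\beta\in\mathbb{R}^p}\{L_n(\beta)+I_{\lambda_n}(\beta)\}$. Convention: $a_n=0$ if $\beta_0=0$. *)

theory Defs
  imports "HOL-Probability.Probability"
begin

section \<open>Stochastic order\<close>

text \<open>
  The events below are measured with the outer measure, which is the ordinary probability
  whenever they are measurable.  It is needed because a penalty may depend on its tuning
  parameter in a non-measurable way, and \<open>measure\<close> is 0 on non-measurable sets.
\<close>

definition vanishes_in_probability :: "'w measure \<Rightarrow> (nat \<Rightarrow> 'w \<Rightarrow> ennreal) \<Rightarrow> bool" where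
  "vanishes_in_probability M Z \<longleftrightarrow>
     (\<forall>\<epsilon>>0. (\<lambda>n. outer_measure_of M {\<omega> \<in> space M. ennreal \<epsilon> < Z n \<omega>}) \<longlonglongrightarrow> 0)"

definition converges_in_probability ::
    "'w measure \<Rightarrow> (nat \<Rightarrow> 'w \<Rightarrow> 'a::metric_space) \<Rightarrow> 'a \<Rightarrow> bool" where
  "converges_in_probability M Z c \<longleftrightarrow>
     vanishes_in_probability M (\<lambda>n \<omega>. ennreal (dist (Z n \<omega>) c))"

definition diverges_in_probability :: "'w measure \<Rightarrow> (nat \<Rightarrow> 'w \<Rightarrow> real) \<Rightarrow> bool" where
  "diverges_in_probability M Z \<longleftrightarrow>
     (\<forall>K. (\<lambda>n. outer_measure_of M {\<omega> \<in> space M. Z n \<omega> \<le> K}) \<longlonglongrightarrow> 0)"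

definition bigO_in_probability ::
    "'w measure \<Rightarrow> (nat \<Rightarrow> 'w \<Rightarrow> real) \<Rightarrow> (nat \<Rightarrow> 'w \<Rightarrow> real) \<Rightarrow> bool" where
  "bigO_in_probability M Z r \<longleftrightarrow>
     (\<forall>\<epsilon>>0. \<exists>C>0. \<forall>\<^sub>F n in sequentially.
        outer_measure_of M {\<omega> \<in> space M. C * r n \<omega> < \<bar>Z n \<omega>\<bar>} \<le> ennreal \<epsilon>)"

section \<open>Logistic model and loss\<close>

definition logistic_cdf :: "real \<Rightarrow> real" where
  "logistic_cdf t = exp t / (1 + exp t)"

definition G_correction :: "(real \<Rightarrow> real) \<Rightarrow> real \<Rightarrow> real" where
  "G_correction \<psi> t = integral {0..t} (\<lambda>u. \<psi> (- ln u))"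

definition logistic_loss :: "(real \<Rightarrow> real) \<Rightarrow> (real \<Rightarrow> real) \<Rightarrow> real \<Rightarrow> real \<Rightarrow> real" where
  "logistic_loss \<rho> \<psi> y t =
     y * \<rho> (- ln (logistic_cdf t)) + (1 - y) * \<rho> (- ln (1 - logistic_cdf t))
     + G_correction \<psi> (logistic_cdf t) + G_correction \<psi> (1 - logistic_cdf t)"

definition loss_nu :: "(real \<Rightarrow> real) \<Rightarrow> real \<Rightarrow> real" where
  "loss_nu \<psi> t =
     \<psi> (- ln (logistic_cdf t)) * (1 - logistic_cdf t)
     + \<psi> (- ln (1 - logistic_cdf t)) * logistic_cdf t"

definition empirical_loss ::
    "(real \<Rightarrow> real) \<Rightarrow> (real \<Rightarrow> real) \<Rightarrow> (real^'p \<Rightarrow> real) \<Rightarrow>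
     (nat \<Rightarrow> real) \<Rightarrow> (nat \<Rightarrow> real^'p) \<Rightarrow> nat \<Rightarrow> real^'p \<Rightarrow> real" where
  "empirical_loss \<rho> \<psi> w ys xs n \<beta> =
     (\<Sum>i=1..n. logistic_loss \<rho> \<psi> (ys i) (xs i \<bullet> \<beta>) * w (xs i)) / real n"

definition hessian_A ::
    "'w measure \<Rightarrow> (real \<Rightarrow> real) \<Rightarrow> (real^'p \<Rightarrow> real) \<Rightarrow> real^'p \<Rightarrow> ('w \<Rightarrow> real^'p) \<Rightarrow> real^'p^'p" where
  "hessian_A M \<psi> w \<beta>\<^sub>0 x =
     (LINT \<omega>|M. (logistic_cdf (x \<omega> \<bullet> \<beta>\<^sub>0) * (1 - logistic_cdf (x \<omega> \<bullet> \<beta>\<^sub>0)) *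
                 loss_nu \<psi> (x \<omega> \<bullet> \<beta>\<^sub>0) * w (x \<omega>)) *\<^sub>R
                ((columnvector (x \<omega>) :: real^1^'p) ** rowvector (x \<omega>)))"

section \<open>Separable penalties\<close>

definition max_slope :: "(real \<Rightarrow> real) \<Rightarrow> real^'p \<Rightarrow> real" where
  "max_slope J' \<beta>\<^sub>0 =
     (if \<beta>\<^sub>0 = 0 then 0 else Max ((\<lambda>l. J' \<bar>\<beta>\<^sub>0 $ l\<bar>) ` {l. \<beta>\<^sub>0 $ l \<noteq> 0}))"

text \<open>
  The supremum is taken in \<^typ>\<open>ennreal\<close>: it may be infinite, and it is 0 when \<open>\<beta>\<^sub>0 = 0\<close>.
\<close>

definition sup_curvature :: "(real \<Rightarrow> real) \<Rightarrow> real^'p \<Rightarrow> real \<Rightarrow> ennreal" where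
  "sup_curvature J'' \<beta>\<^sub>0 \<delta> =
     (SUP l\<in>{l. \<beta>\<^sub>0 $ l \<noteq> 0}. SUP \<tau>\<in>{-1..1}. ennreal \<bar>J'' (\<bar>\<beta>\<^sub>0 $ l\<bar> + \<tau> * \<delta>)\<bar>)"

end

(*
  By Taylor's formula the increment of the empirical loss at beta_0 + h is the score term, which is
  O_P(n^(-1/2)) |h| by Chebyshev's inequality because the score has mean zero, plus half the empirical
  Hessian form at beta_0, plus a remainder.  The empirical Hessian at beta_0 converges to A by the weak
  law of large numbers, and A, being non-negative definite and non-singular, is positive definite; the
  remainder is a small multiple of |h|^2 uniformly for small h.  Hence, near beta_0 and with probability
  close to one, L_n(beta) - L_n(beta_0) >= c |beta - beta_0|^2 - C n^(-1/2) |beta - beta_0|.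
  Minimality of the estimator bounds the left-hand side by the decrease of the penalty, which is at
  most K r_n |h| plus a small multiple of |h|^2 with r_n = lambda_n in (a) and r_n = a_n in (b);
  dividing by |h| gives the rate.
*)
theory Submission
  imports Defs
begin

section \<open>The loss and its derivatives\<close>

text \<open>Three obstacles shape the proof. First, \<open>psi'\<close> is only continuous and
  bounded and only \<open>w(x) |x|^2\<close> has a mean, so the second derivative of the loss need
  not vary uniformly over all covariates when \<open>beta\<close> moves. Covariates are therefore
  cut at a radius \<open>K\<close>. Second, the estimator is random, so the quadratic bound must
  hold for every \<open>beta\<close> in a ball off one single event. Each observation is given a
  remainder bound free of \<open>beta\<close>, and the average of these bounds is controlled by
  Markov's inequality. Third, events that involve the penalty need not be measurable: the loss is
  handled with measurable events and \<open>prob\<close>, the estimator and the penalty with outer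
  measure, and the two meet only in \<open>penalized_rate\<close>.

  The score is centred and the mean Hessian is A for one and the same reason: the correction terms
  make the first derivative a multiple of the residual \<open>y - F(x . beta_0)\<close>, and the
  second derivative differs from the weight in A by another such multiple. Both multiples have
  conditional mean zero given x.\<close>

abbreviation (input) F :: "real \<Rightarrow> real" where "F \<equiv> logistic_cdf"

text \<open>Derivatives are asked for only on the segment, because a penalty \<open>J\<close> is
  differentiable only on the positive reals. A bound on the distance of \<xi> from \<open>t\<close>,
  instead of an ordering of the points, covers both orders and \<open>s = t\<close>.\<close>

lemma Taylor_quadratic:
  fixes f f' f'' :: "real \<Rightarrow> real"
  assumes f: "\<And>u. min s t \<le> u \<Longrightarrow> u \<le> max s t \<Longrightarrow> (f has_real_derivative f' u) (at u)"
    and f': "\<And>u. min s t \<le> u \<Longrightarrow> u \<le> max s t \<Longrightarrow> (f' has_real_derivative f'' u) (at u)"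
  obtains \<xi> where "\<bar>\<xi> - t\<bar> \<le> \<bar>s - t\<bar>"
    and "f s = f t + f' t * (s - t) + f'' \<xi> / 2 * (s - t)\<^sup>2"
proof (cases "s = t")
  case True
  then show ?thesis by (intro that[of t]) auto
next
  case False
  define diff where "diff m = (if m = 0 then f else if m = Suc 0 then f' else f'')" for m :: nat
  have "\<exists>\<xi>. (if s < t then s < \<xi> \<and> \<xi> < t else t < \<xi> \<and> \<xi> < s) \<and>
    f s = (\<Sum>m<2. (diff m t / fact m) * (s - t)^m) + (diff 2 \<xi> / fact 2) * (s - t)^2"
    by (rule Taylor[where a = "min s t" and b = "max s t"])
      (use False f f' in \<open>auto simp: diff_def less_2_cases_iff\<close>)
  then obtain \<xi> where \<xi>: "if s < t then s < \<xi> \<and> \<xi> < t else t < \<xi> \<and> \<xi> < s"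
    "f s = (\<Sum>m<2. (diff m t / fact m) * (s - t)^m) + (diff 2 \<xi> / fact 2) * (s - t)^2"
    by blast
  show ?thesis
    by (rule that[of \<xi>]) (use \<xi> in \<open>auto simp: diff_def numeral_2_eq_2 split: if_splits\<close>)
qed

lemma F_gt_0 [simp]: "0 < F t" and F_lt_1 [simp]: "F t < 1"
  unfolding logistic_cdf_def by (auto simp: field_simps add_pos_pos)

lemma F_nonneg [simp]: "0 \<le> F t" and F_le_1 [simp]: "F t \<le> 1"
  by (simp_all add: less_imp_le)

lemma F_DERIV: "(F has_real_derivative F t * (1 - F t)) (at t)"
proof -
  have "1 + exp t \<noteq> 0"
    using exp_gt_zero[of t] by linarith
  then show ?thesis
    unfolding logistic_cdf_def[abs_def]
    by (auto intro!: derivative_eq_intros simp: divide_simps) (simp add: algebra_simps)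
qed

lemma continuous_F: "continuous_on A F"
  by (rule DERIV_continuous_on) (rule has_field_derivative_at_within[OF F_DERIV])

lemma neg_ln_F_pos: "0 < - ln (F t)" "0 < - ln (1 - F t)"
  by (simp_all add: ln_less_zero_iff)

lemma neg_ln_F_DERIV: "((\<lambda>t. - ln (F t)) has_real_derivative - (1 - F t)) (at t)"
  and neg_ln_1_minus_F_DERIV: "((\<lambda>t. - ln (1 - F t)) has_real_derivative F t) (at t)"
proof -
  have F: "F t \<noteq> 0" "1 - F t \<noteq> 0" "F t \<noteq> 1" "0 < 1 - F t"
    using F_gt_0[of t] F_lt_1[of t] by linarith+
  show "((\<lambda>t. - ln (F t)) has_real_derivative - (1 - F t)) (at t)"
    by (rule DERIV_cong[OF DERIV_minus[OF DERIV_chain2[OF DERIV_ln F_DERIV]]])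
      (use F in \<open>simp_all add: field_simps\<close>)
  have d: "((\<lambda>t. - ln (1 - F t)) has_real_derivative
      - (inverse (1 - F t) * (0 - F t * (1 - F t)))) (at t)"
    by (rule DERIV_minus[OF DERIV_chain2[OF DERIV_ln DERIV_diff[OF DERIV_const F_DERIV]]])
      (rule F)
  have eq: "- (inverse u * (0 - f * u)) = f" if "u \<noteq> 0" for f u :: real
    using that by simp
  show "((\<lambda>t. - ln (1 - F t)) has_real_derivative F t) (at t)"
    by (rule DERIV_cong[OF d eq[OF F(2)]])
qed

section \<open>Derivatives and bounds of the loss for a smooth \<open>rho\<close>\<close>

locale smooth_rho =
  fixes \<rho> \<psi> \<psi>' :: "real \<Rightarrow> real"
  assumes rho_mono: "mono_on {0..} \<rho>"
    and rho_deriv: "\<And>t. t \<ge> 0 \<Longrightarrow> (\<rho> has_real_derivative \<psi> t) (at t within {0..})"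
    and psi_deriv: "\<And>t. t \<ge> 0 \<Longrightarrow> (\<psi> has_real_derivative \<psi>' t) (at t within {0..})"
    and psi'_cont: "continuous_on {0..} \<psi>'"
    and psi_bounded: "bounded (\<psi> ` {0..})" and psi'_bounded: "bounded (\<psi>' ` {0..})"
begin

text \<open>The chain rules below want two-sided derivatives. These exist at interior points of
  \<open>{0..}\<close>, and by \<open>neg_ln_F_pos\<close> the arguments \<open>- ln (F t)\<close>
  and \<open>- ln (1 - F t)\<close> are always such points.\<close>

lemma rho_deriv_at: "(\<rho> has_real_derivative \<psi> t) (at t)"
  and psi_deriv_at: "(\<psi> has_real_derivative \<psi>' t) (at t)" if "0 < t"
proof -
  have "t \<in> interior {0..}"
    using that by simp
  then show "(\<rho> has_real_derivative \<psi> t) (at t)" "(\<psi> has_real_derivative \<psi>' t) (at t)"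
    using rho_deriv[of t] psi_deriv[of t] that by (simp_all add: at_within_interior[of t "{0..}"])
qed

lemma psi_nonneg: "0 \<le> \<psi> t" if "0 < t"
  using mono_on_imp_deriv_nonneg[OF rho_mono rho_deriv_at[OF that]] that by simp

lemma psi_cont: "continuous_on {0..} \<psi>"
  by (rule DERIV_continuous_on[where D = \<psi>']) (auto intro: psi_deriv)

lemma continuous_comp_ln_F:
  assumes "continuous_on {0..} h"
  shows "continuous_on UNIV (\<lambda>t. h (- ln (F t)))" "continuous_on UNIV (\<lambda>t. h (- ln (1 - F t)))"
proof -
  have "continuous_on UNIV (\<lambda>t. - ln (F t))" "continuous_on UNIV (\<lambda>t. - ln (1 - F t))"
    by (rule DERIV_continuous_on, rule neg_ln_F_DERIV neg_ln_1_minus_F_DERIV)+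
  note cont = this
  have *: "- ln (F t) \<in> {0..}" "- ln (1 - F t) \<in> {0..}" for t
    unfolding atLeast_iff by (rule less_imp_le, rule neg_ln_F_pos)+
  show "continuous_on UNIV (\<lambda>t. h (- ln (F t)))"
    by (rule continuous_on_compose2[OF assms cont(1)]) (use * in blast)
  show "continuous_on UNIV (\<lambda>t. h (- ln (1 - F t)))"
    by (rule continuous_on_compose2[OF assms cont(2)]) (use * in blast)
qed

text \<open>\<open>- ln u\<close> is unbounded near 0, so continuity of the integrand on the closed
  interval is not at hand. Boundedness and measurability suffice, by way of the Lebesgue
  integral.\<close>

lemma psi_ln_integrable: "(\<lambda>u. \<psi> (- ln u)) integrable_on {0..1}"
proof -
  \<comment> \<open>\<open>psi\<close> is controlled only on \<open>{0..}\<close>. Clamping its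
    argument at 0 gives a function that is measurable on the whole line and agrees with the
    integrand on \<open>{0..1}\<close>.\<close>
  define g where "g = (\<lambda>u. \<psi> (max 0 (- ln u)))"
  have "continuous_on UNIV (\<lambda>s. \<psi> (max 0 s))"
    by (rule continuous_on_compose2[OF psi_cont]) (auto intro!: continuous_intros)
  then have [measurable]: "(\<lambda>s. \<psi> (max 0 s)) \<in> borel_measurable borel"
    by (rule borel_measurable_continuous_onI)
  have [measurable]: "g \<in> borel_measurable borel"
    unfolding g_def by measurable
  obtain B where B: "\<And>t. t \<ge> 0 \<Longrightarrow> \<bar>\<psi> t\<bar> \<le> B"
    using psi_bounded by (auto simp: bounded_iff)
  have "set_integrable lborel {0..1} g"
    unfolding set_integrable_def
  proof (rule Bochner_Integration.integrable_bound)
    show "integrable lborel (\<lambda>u. indicat_real {0..1::real} u * B)"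
      by (intro integrable_mult_left integrable_real_indicator) auto
    have "\<bar>g u\<bar> \<le> B" for u
      unfolding g_def by (rule B) simp
    then show "AE u in lborel. norm (indicat_real {0..1} u *\<^sub>R g u) \<le> norm (indicat_real {0..1} u * B)"
      using order_trans[OF _ abs_ge_self] by (intro AE_I2) (auto simp: indicator_def)
  qed measurable
  then have "g integrable_on {0..1}"
    by (rule set_borel_integral_eq_integral(1))
  moreover have "g u = \<psi> (- ln u)" if "u \<in> {0..1}" for u
  proof -
    \<comment> \<open>At \<open>u = 0\<close> the convention \<open>ln 0 = 0\<close> makes the
      integrand \<open>psi 0\<close>, and the clamped function takes the same value.\<close>
    have "0 \<le> - ln u"
      using that by (cases "u = 0") auto
    then show ?thesis
      by (simp add: g_def max_def)
  qed
  ultimately show ?thesis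
    by (rule integrable_eq)
qed

text \<open>The integrand may be discontinuous at 0, so the fundamental theorem is applied with base
  point \<open>a = t / 2\<close>; the integral over \<open>{0..a}\<close> is then an additive
  constant. The upper end \<open>b < 1\<close> keeps \<open>- ln u\<close> in the domain of
  \<open>psi\<close>.\<close>

lemma G_correction_deriv:
  assumes t: "0 < t" "t < 1"
  shows "(G_correction \<psi> has_real_derivative \<psi> (- ln t)) (at t)"
proof -
  define a where "a = t / 2"
  define b where "b = (t + 1) / 2"
  have ab: "0 < a" "a < t" "t < b" "b < 1"
    using t by (auto simp: a_def b_def)
  let ?g = "\<lambda>u. \<psi> (- ln u)"
  have "continuous_on {a..b} ?g"
    using ab by (intro continuous_on_compose2[OF psi_cont] continuous_intros) auto
  then have "((\<lambda>s. integral {a..s} ?g) has_real_derivative ?g t) (at t within {a..b})"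
    using ab by (intro integral_has_real_derivative) auto
  moreover have "t \<in> interior {a..b}"
    using ab by simp
  ultimately have d: "((\<lambda>s. integral {a..s} ?g) has_real_derivative ?g t) (at t)"
    by (simp add: at_within_interior[of t "{a..b}"])
  have "((\<lambda>s. integral {0..a} ?g + integral {a..s} ?g) has_real_derivative 0 + ?g t) (at t)"
    by (intro DERIV_add DERIV_const d)
  moreover have "integral {0..a} ?g + integral {a..s} ?g = G_correction \<psi> s" if "s \<in> {a<..<b}" for s
  proof -
    have "?g integrable_on {0..s}"
      by (rule integrable_on_subinterval[OF psi_ln_integrable]) (use that ab in simp)
    then show ?thesis
      unfolding G_correction_def
      by (rule Henstock_Kurzweil_Integration.integral_combine[rotated 2]) (use that ab in simp_all)
  qed
  moreover have "open {a<..<b}" "t \<in> {a<..<b}"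
    using ab by simp_all
  ultimately have "(G_correction \<psi> has_real_derivative 0 + ?g t) (at t)"
    using has_field_derivative_transform_within_open[of _ _ t "{a<..<b}"] by blast
  then show ?thesis
    by simp
qed

definition nu' :: "real \<Rightarrow> real" where
  "nu' t = - \<psi>' (- ln (F t)) * (1 - F t)\<^sup>2 + \<psi>' (- ln (1 - F t)) * (F t)\<^sup>2
     + F t * (1 - F t) * (\<psi> (- ln (1 - F t)) - \<psi> (- ln (F t)))"

definition phi1 :: "real \<Rightarrow> real \<Rightarrow> real" where
  "phi1 y t = - (y - F t) * loss_nu \<psi> t"

text \<open>The first summand is the weight that appears in A. The second is a multiple of the
  residual, so at \<open>beta_0\<close> it has conditional mean zero given x.\<close>

definition phi2 :: "real \<Rightarrow> real \<Rightarrow> real" where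
  "phi2 y t = F t * (1 - F t) * loss_nu \<psi> t - (y - F t) * nu' t"

text \<open>Here the correction terms earn their place: they contribute \<open>F (1 - F)\<close>
  times the difference of the two \<open>psi\<close> values, exactly what is missing for the
  derivative to factor as minus the residual times \<open>nu\<close>.\<close>

lemma loss_DERIV: "(logistic_loss \<rho> \<psi> y has_real_derivative phi1 y t) (at t)"
proof -
  have r1: "((\<lambda>t. \<rho> (- ln (F t))) has_real_derivative \<psi> (- ln (F t)) * - (1 - F t)) (at t)"
    by (rule DERIV_chain2[OF rho_deriv_at neg_ln_F_DERIV]) (rule neg_ln_F_pos)
  have r2: "((\<lambda>t. \<rho> (- ln (1 - F t))) has_real_derivative \<psi> (- ln (1 - F t)) * F t) (at t)"
    by (rule DERIV_chain2[OF rho_deriv_at neg_ln_1_minus_F_DERIV]) (rule neg_ln_F_pos)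
  have g1: "((\<lambda>t. G_correction \<psi> (F t)) has_real_derivative
      \<psi> (- ln (F t)) * (F t * (1 - F t))) (at t)"
    by (rule DERIV_chain2[OF G_correction_deriv F_DERIV]) simp_all
  have g2: "((\<lambda>t. G_correction \<psi> (1 - F t)) has_real_derivative
      \<psi> (- ln (1 - F t)) * (0 - F t * (1 - F t))) (at t)"
    by (rule DERIV_chain2[OF G_correction_deriv DERIV_diff[OF DERIV_const F_DERIV]]) simp_all
  have d: "(logistic_loss \<rho> \<psi> y has_real_derivative
      y * (\<psi> (- ln (F t)) * - (1 - F t)) + (1 - y) * (\<psi> (- ln (1 - F t)) * F t)
      + \<psi> (- ln (F t)) * (F t * (1 - F t)) + \<psi> (- ln (1 - F t)) * (0 - F t * (1 - F t))) (at t)"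
    unfolding logistic_loss_def[abs_def]
    by (rule DERIV_add[OF DERIV_add[OF DERIV_add[OF DERIV_cmult[OF r1] DERIV_cmult[OF r2]] g1] g2])
  have eq: "y * (p * - (1 - f)) + (1 - y) * (q * f) + p * (f * (1 - f)) + q * (0 - f * (1 - f))
      = - (y - f) * (p * (1 - f) + q * f)" for p q f :: real
    by (simp add: algebra_simps)
  show ?thesis
    unfolding phi1_def loss_nu_def
    by (rule DERIV_cong[OF d eq])
qed

lemma loss_nu_DERIV: "(loss_nu \<psi> has_real_derivative nu' t) (at t)"
proof -
  have p1: "((\<lambda>t. \<psi> (- ln (F t))) has_real_derivative \<psi>' (- ln (F t)) * - (1 - F t)) (at t)"
    by (rule DERIV_chain2[OF psi_deriv_at neg_ln_F_DERIV]) (rule neg_ln_F_pos)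
  have p2: "((\<lambda>t. \<psi> (- ln (1 - F t))) has_real_derivative \<psi>' (- ln (1 - F t)) * F t) (at t)"
    by (rule DERIV_chain2[OF psi_deriv_at neg_ln_1_minus_F_DERIV]) (rule neg_ln_F_pos)
  have f: "((\<lambda>t. 1 - F t) has_real_derivative 0 - F t * (1 - F t)) (at t)"
    by (rule DERIV_diff[OF DERIV_const F_DERIV])
  have m1: "((\<lambda>t. \<psi> (- ln (F t)) * (1 - F t)) has_real_derivative
      (\<psi>' (- ln (F t)) * - (1 - F t)) * (1 - F t) + (0 - F t * (1 - F t)) * \<psi> (- ln (F t))) (at t)"
    by (rule DERIV_mult[OF p1 f])
  have m2: "((\<lambda>t. \<psi> (- ln (1 - F t)) * F t) has_real_derivative
      (\<psi>' (- ln (1 - F t)) * F t) * F t + (F t * (1 - F t)) * \<psi> (- ln (1 - F t))) (at t)"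
    by (rule DERIV_mult[OF p2 F_DERIV])
  have eq: "(p' * - (1 - f)) * (1 - f) + (0 - f * (1 - f)) * p + ((q' * f) * f + (f * (1 - f)) * q)
      = - p' * (1 - f)\<^sup>2 + q' * f\<^sup>2 + f * (1 - f) * (q - p)" for p p' q q' f :: real
    by (simp add: algebra_simps power2_eq_square)
  show ?thesis
    unfolding nu'_def loss_nu_def[abs_def]
    by (rule DERIV_cong[OF DERIV_add[OF m1 m2] eq])
qed

lemma phi1_DERIV: "(phi1 y has_real_derivative phi2 y t) (at t)"
proof -
  have f: "((\<lambda>t. - (y - F t)) has_real_derivative - (0 - F t * (1 - F t))) (at t)"
    by (rule DERIV_minus[OF DERIV_diff[OF DERIV_const F_DERIV]])
  have d: "(phi1 y has_real_derivative
      - (0 - F t * (1 - F t)) * loss_nu \<psi> t + nu' t * - (y - F t)) (at t)"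
    unfolding phi1_def[abs_def]
    by (rule DERIV_mult[OF f loss_nu_DERIV])
  have eq: "- (0 - f * (1 - f)) * n + n' * - (y - f) = f * (1 - f) * n - (y - f) * n'"
    for f n n' :: real
    by (simp add: algebra_simps)
  show ?thesis
    unfolding phi2_def
    by (rule DERIV_cong[OF d eq])
qed

lemma loss_nu_nonneg: "0 \<le> loss_nu \<psi> t"
  unfolding loss_nu_def
  by (intro add_nonneg_nonneg mult_nonneg_nonneg psi_nonneg neg_ln_F_pos) (simp_all add: less_imp_le)

lemma continuous_loss_nu: "continuous_on UNIV (loss_nu \<psi>)"
  by (rule DERIV_continuous_on) (rule has_field_derivative_at_within[OF loss_nu_DERIV])

lemma continuous_nu': "continuous_on UNIV nu'"
proof -
  note * = continuous_comp_ln_F(1)[OF psi_cont] continuous_comp_ln_F(2)[OF psi_cont]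
    continuous_comp_ln_F(1)[OF psi'_cont] continuous_comp_ln_F(2)[OF psi'_cont]
  show ?thesis
    unfolding nu'_def[abs_def]
    by (intro continuous_on_add continuous_on_diff continuous_on_mult continuous_on_minus
        continuous_on_power continuous_on_const continuous_F *)
qed

lemma continuous_phi2: "continuous_on UNIV (phi2 y)"
  unfolding phi2_def[abs_def]
  by (intro continuous_on_diff continuous_on_mult continuous_on_const
      continuous_F continuous_loss_nu continuous_nu')

text \<open>Expanded, \<open>nu'\<close> is a sum of four products of a value of \<open>psi\<close>
  or \<open>psi'\<close> with a factor in [-1, 1], and \<open>nu\<close> is a sum of two; hence the
  crude common bound \<open>4 * B\<close>.\<close>

lemma loss_nu_nu'_bounded:
  obtains B where "0 < B" "\<And>t. \<bar>loss_nu \<psi> t\<bar> \<le> B" "\<And>t. \<bar>nu' t\<bar> \<le> B"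
proof -
  obtain B0 where B0: "\<And>t. t \<ge> 0 \<Longrightarrow> \<bar>\<psi> t\<bar> \<le> B0"
    using psi_bounded by (auto simp: bounded_iff)
  obtain B1 where B1: "\<And>t. t \<ge> 0 \<Longrightarrow> \<bar>\<psi>' t\<bar> \<le> B1"
    using psi'_bounded by (auto simp: bounded_iff)
  define B where "B = max 1 (max B0 B1)"
  have B: "0 < B" "\<And>t. t \<ge> 0 \<Longrightarrow> \<bar>\<psi> t\<bar> \<le> B" "\<And>t. t \<ge> 0 \<Longrightarrow> \<bar>\<psi>' t\<bar> \<le> B"
    using B0 B1 by (simp_all add: B_def le_max_iff_disj)
  have mult: "\<bar>a * b\<bar> \<le> B" if "\<bar>a\<bar> \<le> B" "\<bar>b\<bar> \<le> 1" for a b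
    using mult_mono[OF that] B(1) by (simp add: abs_mult)
  have pos: "0 \<le> - ln (F t)" "0 \<le> - ln (1 - F t)" for t
    using less_imp_le neg_ln_F_pos by blast+
  have F01: "\<bar>F t\<bar> \<le> 1" "\<bar>1 - F t\<bar> \<le> 1" "\<bar>(F t)\<^sup>2\<bar> \<le> 1" "\<bar>(1 - F t)\<^sup>2\<bar> \<le> 1" for t
    by (simp_all add: abs_square_le_1)
  have FF: "\<bar>F t * (1 - F t)\<bar> \<le> 1" for t
    using mult_mono[OF F01(1) F01(2)] by (simp add: abs_mult)
  have "\<bar>loss_nu \<psi> t\<bar> \<le> 4 * B" for t
    using mult[OF B(2)[OF pos(1)] F01(2), of t t] mult[OF B(2)[OF pos(2)] F01(1), of t t] B(1)
    unfolding loss_nu_def by linarith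
  moreover have "\<bar>nu' t\<bar> \<le> 4 * B" for t
  proof -
    have "\<bar>F t * (1 - F t) * (\<psi> (- ln (1 - F t)) - \<psi> (- ln (F t)))\<bar> \<le> 2 * B"
      using mult[OF B(2)[OF pos(1)] FF, of t t] mult[OF B(2)[OF pos(2)] FF, of t t]
      by (simp add: algebra_simps)
    then show ?thesis
      using mult[OF B(3)[OF pos(1)] F01(4), of t t] mult[OF B(3)[OF pos(2)] F01(3), of t t]
      unfolding nu'_def by linarith
  qed
  ultimately show thesis
    using that[of "4 * B"] B(1) by simp
qed

lemma loss_Taylor:
  obtains \<xi> where "\<bar>\<xi> - t\<bar> \<le> \<bar>s - t\<bar>"
    and "logistic_loss \<rho> \<psi> y s
      = logistic_loss \<rho> \<psi> y t + phi1 y t * (s - t) + phi2 y \<xi> / 2 * (s - t)\<^sup>2"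
  by (rule Taylor_quadratic[OF loss_DERIV phi1_DERIV])

end

section \<open>Averages of independent samples\<close>

text \<open>\<open>W0\<close> is the generic copy, on which moments are stated once and for all. The
  sample starts at index 1; \<open>W 0\<close> is unconstrained.\<close>

locale iid_sample = prob_space M for M :: "'w measure" +
  fixes W0 :: "'w \<Rightarrow> 'b::topological_space" and W :: "nat \<Rightarrow> 'w \<Rightarrow> 'b"
  assumes W0_measurable [measurable]: "W0 \<in> borel_measurable M"
    and indep: "indep_vars (\<lambda>_. borel) W {1..}"
    and ident: "\<And>i. 1 \<le> i \<Longrightarrow> distr M borel (W i) = distr M borel W0"
begin

lemma W_measurable: "1 \<le> i \<Longrightarrow> W i \<in> borel_measurable M"
  using indep by (auto simp: indep_vars_def)

definition avg :: "('b \<Rightarrow> real) \<Rightarrow> nat \<Rightarrow> 'w \<Rightarrow> real" where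
  "avg f n \<omega> = (\<Sum>i=1..n. f (W i \<omega>)) / real n"

lemma avg_measurable [measurable]:
  assumes [measurable]: "f \<in> borel_measurable borel"
  shows "avg f n \<in> borel_measurable M"
proof -
  have "(\<lambda>\<omega>. f (W i \<omega>)) \<in> borel_measurable M" if "i \<in> {1..n}" for i
    using that by (intro measurable_compose[OF W_measurable assms]) simp
  then show ?thesis
    unfolding avg_def[abs_def] by measurable
qed

lemma avg_add: "avg (\<lambda>v. f v + g v) n \<omega> = avg f n \<omega> + avg g n \<omega>"
  and avg_diff: "avg (\<lambda>v. f v - g v) n \<omega> = avg f n \<omega> - avg g n \<omega>"
  and avg_cmult: "avg (\<lambda>v. c * f v) n \<omega> = c * avg f n \<omega>"
  by (simp_all add: avg_def sum.distrib sum_subtractf add_divide_distrib diff_divide_distrib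
      sum_distrib_left)

lemma avg_sum: "avg (\<lambda>v. \<Sum>j\<in>A. f j v) n \<omega> = (\<Sum>j\<in>A. avg (f j) n \<omega>)"
  unfolding avg_def sum_divide_distrib[symmetric] by (subst sum.swap) simp

lemma avg_mono:
  assumes "\<And>i. 1 \<le> i \<Longrightarrow> f (W i \<omega>) \<le> g (W i \<omega>)"
  shows "avg f n \<omega> \<le> avg g n \<omega>"
  unfolding avg_def using assms by (intro divide_right_mono sum_mono) auto

lemma integrable_W:
  fixes f :: "'b \<Rightarrow> real"
  assumes "1 \<le> i" and f: "f \<in> borel_measurable borel"
  shows "integrable M (\<lambda>\<omega>. f (W i \<omega>)) \<longleftrightarrow> integrable M (\<lambda>\<omega>. f (W0 \<omega>))"
  using integrable_distr_eq[OF W_measurable f] integrable_distr_eq[OF W0_measurable f] assms ident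
  by metis

lemma expectation_W:
  fixes f :: "'b \<Rightarrow> real"
  assumes "1 \<le> i" and f: "f \<in> borel_measurable borel"
  shows "expectation (\<lambda>\<omega>. f (W i \<omega>)) = expectation (\<lambda>\<omega>. f (W0 \<omega>))"
  using integral_distr[OF W_measurable f] integral_distr[OF W0_measurable f] assms ident by metis

lemma integrable_avg:
  assumes "f \<in> borel_measurable borel" "integrable M (\<lambda>\<omega>. f (W0 \<omega>))"
  shows "integrable M (avg f n)"
  unfolding avg_def[abs_def] using assms
  by (intro integrable_divide_zero Bochner_Integration.integrable_sum impI) (simp add: integrable_W)

lemma expectation_avg:
  assumes "f \<in> borel_measurable borel" "integrable M (\<lambda>\<omega>. f (W0 \<omega>))" "0 < n"
  shows "expectation (avg f n) = expectation (\<lambda>\<omega>. f (W0 \<omega>))"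
proof -
  have "expectation (avg f n) = (\<Sum>i=1..n. expectation (\<lambda>\<omega>. f (W i \<omega>))) / real n"
    unfolding avg_def[abs_def] using assms
    by (simp add: Bochner_Integration.integral_sum integrable_W)
  also have "\<dots> = (\<Sum>i=1..n. expectation (\<lambda>\<omega>. f (W0 \<omega>))) / real n"
    using assms by (simp add: expectation_W)
  finally show ?thesis
    using assms by simp
qed

lemma avg_Markov:
  assumes f [measurable]: "f \<in> borel_measurable borel" and int: "integrable M (\<lambda>\<omega>. f (W0 \<omega>))"
    and nonneg: "\<And>v. 0 \<le> f v" and "0 < n" "0 < c"
  shows "prob {\<omega> \<in> space M. c \<le> avg f n \<omega>} \<le> expectation (\<lambda>\<omega>. f (W0 \<omega>)) / c"
proof -
  have "0 \<le> avg f n \<omega>" for \<omega>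
    using nonneg by (auto simp: avg_def intro!: sum_nonneg divide_nonneg_nonneg)
  then have "prob {\<omega> \<in> space M. c \<le> avg f n \<omega>} \<le> expectation (avg f n) / c"
    using integrable_avg[OF f int] \<open>0 < c\<close>
    by (intro integral_Markov_inequality_measure[where A = "{}"]) simp_all
  then show ?thesis
    using expectation_avg[OF f int \<open>0 < n\<close>] by simp
qed

text \<open>Expanding the square of the average leaves only the diagonal: off it, independence turns
  the expectation into a product of zero means. The second moment is thus \<open>V / n\<close>,
  which is the source of the root-n rate of the score and also settles the truncated part of the
  weak law.\<close>

lemma avg_Chebyshev:
  assumes f [measurable]: "f \<in> borel_measurable borel"
    and int2: "integrable M (\<lambda>\<omega>. (f (W0 \<omega>))\<^sup>2)" and mean: "expectation (\<lambda>\<omega>. f (W0 \<omega>)) = 0"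
    and "0 < n" "0 < a"
  shows "prob {\<omega> \<in> space M. a \<le> \<bar>avg f n \<omega>\<bar>} \<le> expectation (\<lambda>\<omega>. (f (W0 \<omega>))\<^sup>2) / (real n * a\<^sup>2)"
proof -
  define V where "V = expectation (\<lambda>\<omega>. (f (W0 \<omega>))\<^sup>2)"
  have int: "integrable M (\<lambda>\<omega>. f (W0 \<omega>))"
    by (rule square_integrable_imp_integrable[OF _ int2]) measurable
  have prod: "integrable M (\<lambda>\<omega>. f (W i \<omega>) * f (W j \<omega>)) \<and>
      expectation (\<lambda>\<omega>. f (W i \<omega>) * f (W j \<omega>)) = (if i = j then V else 0)"
    if ij: "i \<in> {1..n}" "j \<in> {1..n}" for i j
  proof (cases "i = j")
    case True
    then show ?thesis
      using integrable_W[of i "\<lambda>v. (f v)\<^sup>2"] expectation_W[of i "\<lambda>v. (f v)\<^sup>2"] int2 ij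
      by (simp add: V_def power2_eq_square)
  next
    case False
    have "indep_vars (\<lambda>_. borel) W {i, j}"
      by (rule indep_vars_subset[OF indep]) (use ij in auto)
    then have I: "indep_vars (\<lambda>_. borel) (\<lambda>k \<omega>. f (W k \<omega>)) {i, j}"
      by (rule indep_vars_compose2) simp
    have "integrable M (\<lambda>\<omega>. f (W k \<omega>))" if "k \<in> {i, j}" for k
      using that ij int by (auto simp: integrable_W)
    note indep_vars_lebesgue_integral[OF _ I this] indep_vars_integrable[OF _ I this]
    then show ?thesis
      using False ij mean by (simp add: expectation_W)
  qed
  have square: "(avg f n \<omega>)\<^sup>2 = (\<Sum>i=1..n. \<Sum>j=1..n. f (W i \<omega>) * f (W j \<omega>)) / (real n)\<^sup>2" for \<omega>
    by (simp add: avg_def power_divide power2_eq_square sum_product)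
  have "integrable M (\<lambda>\<omega>. (avg f n \<omega>)\<^sup>2)"
    unfolding square using prod
    by (intro integrable_divide_zero Bochner_Integration.integrable_sum impI) blast
  moreover have "expectation (\<lambda>\<omega>. (avg f n \<omega>)\<^sup>2)
      = (\<Sum>i=1..n. \<Sum>j=1..n. if i = j then V else 0) / (real n)\<^sup>2"
  proof -
    have "expectation (\<lambda>\<omega>. \<Sum>i=1..n. \<Sum>j=1..n. f (W i \<omega>) * f (W j \<omega>))
        = (\<Sum>i=1..n. expectation (\<lambda>\<omega>. \<Sum>j=1..n. f (W i \<omega>) * f (W j \<omega>)))"
      using prod by (intro Bochner_Integration.integral_sum Bochner_Integration.integrable_sum) blast
    also have "\<dots> = (\<Sum>i=1..n. \<Sum>j=1..n. expectation (\<lambda>\<omega>. f (W i \<omega>) * f (W j \<omega>)))"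
      using prod by (intro sum.cong refl Bochner_Integration.integral_sum) blast
    also have "\<dots> = (\<Sum>i=1..n. \<Sum>j=1..n. if i = j then V else 0)"
      using prod by (intro sum.cong refl) blast
    finally show ?thesis
      unfolding square by simp
  qed
  then have "expectation (\<lambda>\<omega>. (avg f n \<omega>)\<^sup>2) = V / real n"
    using \<open>0 < n\<close> by (simp add: power2_eq_square)
  ultimately show ?thesis
    using second_moment_method[of "avg f n" a] \<open>0 < a\<close> by (simp add: V_def)
qed

text \<open>Dominated convergence. The function \<open>h\<close> that measures the tail is kept
  apart from \<open>g\<close>: the weak law cuts at \<open>|f|\<close> itself, whereas the Taylor
  remainder cuts \<open>w |x|^2\<close> at the norm of x.\<close>

lemma integrable_tail:
  fixes g h :: "'w \<Rightarrow> real"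
  assumes int: "integrable M g" and [measurable]: "h \<in> borel_measurable M" and "0 < \<delta>"
  obtains K :: nat where "expectation (\<lambda>\<omega>. \<bar>g \<omega>\<bar> * indicat_real {\<omega>. real K < h \<omega>} \<omega>) \<le> \<delta>"
proof -
  have [measurable]: "g \<in> borel_measurable M"
    using int by simp
  have "(\<lambda>k. expectation (\<lambda>\<omega>. if real k < h \<omega> then \<bar>g \<omega>\<bar> else 0)) \<longlonglongrightarrow> expectation (\<lambda>_. 0)"
  proof (rule integral_dominated_convergence)
    show "integrable M (\<lambda>\<omega>. \<bar>g \<omega>\<bar>)"
      using int by simp
    have "(\<lambda>k. if real k < h \<omega> then \<bar>g \<omega>\<bar> else 0) \<longlonglongrightarrow> 0" for \<omega>
    proof (rule tendsto_eventually)
      obtain N where "h \<omega> \<le> real N"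
        using real_arch_simple by blast
      then show "\<forall>\<^sub>F k in sequentially. (if real k < h \<omega> then \<bar>g \<omega>\<bar> else 0) = 0"
        by (intro eventually_sequentiallyI[of N]) auto
    qed
    then show "AE \<omega> in M. (\<lambda>k. if real k < h \<omega> then \<bar>g \<omega>\<bar> else 0) \<longlonglongrightarrow> 0"
      by simp
  qed auto
  then have "\<forall>\<^sub>F k in sequentially. expectation (\<lambda>\<omega>. if real k < h \<omega> then \<bar>g \<omega>\<bar> else 0) < \<delta>"
    using \<open>0 < \<delta>\<close> by (intro order_tendstoD) simp_all
  then obtain K where "expectation (\<lambda>\<omega>. if real K < h \<omega> then \<bar>g \<omega>\<bar> else 0) < \<delta>"
    by (auto simp: eventually_sequentially)
  moreover have "(\<lambda>\<omega>. if real K < h \<omega> then \<bar>g \<omega>\<bar> else 0)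
      = (\<lambda>\<omega>. \<bar>g \<omega>\<bar> * indicat_real {\<omega>. real K < h \<omega>} \<omega>)"
    by (auto simp: indicator_def)
  ultimately show thesis
    using that[of K] by simp
qed

text \<open>Truncation at a level \<open>K\<close> reduces the weak law to \<open>avg_Chebyshev\<close> and \<open>avg_Markov\<close>.\<close>

lemma weak_law_of_large_numbers:
  assumes f [measurable]: "f \<in> borel_measurable borel" and int: "integrable M (\<lambda>\<omega>. f (W0 \<omega>))"
    and "0 < \<kappa>" "0 < \<epsilon>"
  shows "\<forall>\<^sub>F n in sequentially.
    prob {\<omega> \<in> space M. \<kappa> \<le> \<bar>avg f n \<omega> - expectation (\<lambda>\<omega>. f (W0 \<omega>))\<bar>} \<le> \<epsilon>"
proof -
  \<comment> \<open>\<delta> bounds the mean absolute value of the discarded part. Below \<kappa> /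
    3 it absorbs the shift of the mean; at most \<kappa> * \<epsilon> / 6 it makes Markov's
    inequality at level \<kappa> / 3 cost at most \<epsilon> / 2.\<close>
  define \<delta> where "\<delta> = min (\<kappa> / 4) (\<kappa> * \<epsilon> / 6)"
  have \<delta>: "0 < \<delta>" "\<delta> < \<kappa> / 3" "3 * \<delta> / \<kappa> \<le> \<epsilon> / 2"
    using assms by (auto simp: \<delta>_def min_def field_simps)
  obtain K :: nat where
    K: "expectation (\<lambda>\<omega>. \<bar>f (W0 \<omega>)\<bar> * indicat_real {\<omega>. real K < \<bar>f (W0 \<omega>)\<bar>} \<omega>) \<le> \<delta>"
    by (rule integrable_tail[OF int _ \<delta>(1), of "\<lambda>\<omega>. \<bar>f (W0 \<omega>)\<bar>"]) auto
  define g where "g v = (if \<bar>f v\<bar> \<le> real K then f v else 0)" for v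
  define h where "h v = \<bar>f v - g v\<bar>" for v
  define m where "m = expectation (\<lambda>\<omega>. g (W0 \<omega>))"
  have [measurable]: "g \<in> borel_measurable borel" "h \<in> borel_measurable borel"
    unfolding g_def h_def by measurable
  have g_bound: "\<bar>g v\<bar> \<le> real K" for v
    by (simp add: g_def)
  have int_g: "integrable M (\<lambda>\<omega>. g (W0 \<omega>))"
    by (rule integrable_const_bound[of _ "real K"]) (use g_bound in auto)
  have int_h: "integrable M (\<lambda>\<omega>. h (W0 \<omega>))"
    unfolding h_def using int int_g by (intro integrable_abs Bochner_Integration.integrable_diff)
  have "(\<lambda>\<omega>. h (W0 \<omega>)) = (\<lambda>\<omega>. \<bar>f (W0 \<omega>)\<bar> * indicat_real {\<omega>. real K < \<bar>f (W0 \<omega>)\<bar>} \<omega>)"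
    by (auto simp: h_def g_def indicator_def)
  then have Eh: "expectation (\<lambda>\<omega>. h (W0 \<omega>)) \<le> \<delta>"
    using K by simp
  have gm_bound: "\<bar>g v - m\<bar> \<le> real K + \<bar>m\<bar>" for v
    using g_bound[of v] by linarith
  have int_gm2: "integrable M (\<lambda>\<omega>. (g (W0 \<omega>) - m)\<^sup>2)"
    by (rule integrable_const_bound[of _ "(real K + \<bar>m\<bar>)\<^sup>2"])
      (use power_mono[OF gm_bound abs_ge_zero, of _ 2] in auto)
  have mean_gm: "expectation (\<lambda>\<omega>. g (W0 \<omega>) - m) = 0"
    using int_g by (simp add: m_def prob_space)
  define V where "V = expectation (\<lambda>\<omega>. (g (W0 \<omega>) - m)\<^sup>2)"
  have mean_diff: "\<bar>expectation (\<lambda>\<omega>. f (W0 \<omega>)) - m\<bar> \<le> \<delta>"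
  proof -
    have "expectation (\<lambda>\<omega>. f (W0 \<omega>)) - m = expectation (\<lambda>\<omega>. f (W0 \<omega>) - g (W0 \<omega>))"
      using int int_g by (simp add: m_def)
    also have "\<bar>\<dots>\<bar> \<le> expectation (\<lambda>\<omega>. h (W0 \<omega>))"
      unfolding h_def by (rule integral_abs_bound)
    finally show ?thesis
      using Eh by simp
  qed
  \<comment> \<open>This is \<open>V / (n (\<kappa> / 3)^2) <= \<epsilon> / 2\<close> solved for
    n.\<close>
  obtain N :: nat where N: "18 * V / (\<kappa>\<^sup>2 * \<epsilon>) \<le> real N"
    using real_arch_simple by blast
  show ?thesis
  proof (rule eventually_sequentiallyI[of "max 1 N"])
    fix n assume "max 1 N \<le> n"
    then have n: "0 < n" "18 * V / (\<kappa>\<^sup>2 * \<epsilon>) \<le> real n"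
      using N by auto
    \<comment> \<open>Centred truncated part, discarded part, and shift of the mean. The last is
      below \<kappa> / 3, so a deviation of size \<kappa> forces one of the first two to reach
      \<kappa> / 3.\<close>
    have avg_le: "\<bar>avg f n \<omega> - expectation (\<lambda>\<omega>. f (W0 \<omega>))\<bar> \<le>
        \<bar>avg (\<lambda>v. g v - m) n \<omega>\<bar> + avg h n \<omega> + \<delta>" for \<omega>
    proof -
      have "avg f n \<omega> - m = avg (\<lambda>v. g v - m) n \<omega> + avg (\<lambda>v. f v - g v) n \<omega>"
        using n(1) by (simp add: avg_def sum_subtractf field_simps)
      moreover have "\<bar>avg (\<lambda>v. f v - g v) n \<omega>\<bar> \<le> avg h n \<omega>"
        unfolding avg_def h_def abs_divide by (auto intro!: divide_right_mono sum_abs)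
      ultimately show ?thesis
        using mean_diff by linarith
    qed
    have "prob {\<omega> \<in> space M. \<kappa> \<le> \<bar>avg f n \<omega> - expectation (\<lambda>\<omega>. f (W0 \<omega>))\<bar>}
      \<le> prob ({\<omega> \<in> space M. \<kappa> / 3 \<le> \<bar>avg (\<lambda>v. g v - m) n \<omega>\<bar>} \<union> {\<omega> \<in> space M. \<kappa> / 3 \<le> avg h n \<omega>})"
    proof (intro finite_measure_mono subsetI)
      fix \<omega> assume "\<omega> \<in> {\<omega> \<in> space M. \<kappa> \<le> \<bar>avg f n \<omega> - expectation (\<lambda>\<omega>. f (W0 \<omega>))\<bar>}"
      then show "\<omega> \<in> {\<omega> \<in> space M. \<kappa> / 3 \<le> \<bar>avg (\<lambda>v. g v - m) n \<omega>\<bar>} \<union>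
          {\<omega> \<in> space M. \<kappa> / 3 \<le> avg h n \<omega>}"
        using avg_le[of \<omega>] \<delta>(2) by auto
    qed measurable
    also have "\<dots> \<le> prob {\<omega> \<in> space M. \<kappa> / 3 \<le> \<bar>avg (\<lambda>v. g v - m) n \<omega>\<bar>}
        + prob {\<omega> \<in> space M. \<kappa> / 3 \<le> avg h n \<omega>}"
      by (rule measure_Un_le) measurable
    also have "prob {\<omega> \<in> space M. \<kappa> / 3 \<le> \<bar>avg (\<lambda>v. g v - m) n \<omega>\<bar>} \<le> V / (real n * (\<kappa> / 3)\<^sup>2)"
      unfolding V_def
      by (rule avg_Chebyshev) (use n(1) \<open>0 < \<kappa>\<close> int_gm2 mean_gm in auto)
    also have "V / (real n * (\<kappa> / 3)\<^sup>2) \<le> \<epsilon> / 2"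
      using n assms by (simp add: field_simps)
    also have "prob {\<omega> \<in> space M. \<kappa> / 3 \<le> avg h n \<omega>} \<le> expectation (\<lambda>\<omega>. h (W0 \<omega>)) / (\<kappa> / 3)"
      by (rule avg_Markov) (use n(1) \<open>0 < \<kappa>\<close> int_h in \<open>auto simp: h_def\<close>)
    also have "\<dots> \<le> \<epsilon> / 2"
      using Eh \<delta>(3) \<open>0 < \<kappa>\<close> by (simp add: field_simps)
    finally show "prob {\<omega> \<in> space M. \<kappa> \<le> \<bar>avg f n \<omega> - expectation (\<lambda>\<omega>. f (W0 \<omega>))\<bar>} \<le> \<epsilon>"
      by simp
  qed
qed

end

section \<open>Quadratic lower bound for the empirical loss\<close>

locale logistic_sample =
  smooth_rho \<rho> \<psi> \<psi>' + iid_sample M "\<lambda>\<omega>. (y \<omega>, x \<omega>)" "\<lambda>i \<omega>. (ys i \<omega>, xs i \<omega>)"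
  for \<rho> \<psi> \<psi>' :: "real \<Rightarrow> real" and M :: "'w measure"
    and y :: "'w \<Rightarrow> real" and x :: "'w \<Rightarrow> real^'p"
    and ys :: "nat \<Rightarrow> 'w \<Rightarrow> real" and xs :: "nat \<Rightarrow> 'w \<Rightarrow> real^'p" +
  fixes \<beta>\<^sub>0 :: "real^'p" and w :: "real^'p \<Rightarrow> real"
  assumes y_01: "\<And>\<omega>. \<omega> \<in> space M \<Longrightarrow> y \<omega> \<in> {0, 1}"
    and model: "AE \<omega> in M.
        real_cond_exp M (vimage_algebra (space M) x borel) (indicat_real {\<omega> \<in> space M. y \<omega> = 1}) \<omega>
          = F (x \<omega> \<bullet> \<beta>\<^sub>0)"
    and ys_01: "\<And>i \<omega>. 1 \<le> i \<Longrightarrow> \<omega> \<in> space M \<Longrightarrow> ys i \<omega> \<in> {0, 1}"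
    and w_measurable [measurable]: "w \<in> borel_measurable borel"
    and w_nonneg: "\<And>v. 0 \<le> w v" and w_le_1: "\<And>v. w v \<le> 1"
    and second_moment: "integrable M (\<lambda>\<omega>. w (x \<omega>) * (norm (x \<omega>))\<^sup>2)"
    and hessian_invertible: "invertible (hessian_A M \<psi> w \<beta>\<^sub>0 x)"
begin

lemma measurable_fst_borel [measurable]: "fst \<in> borel_measurable (borel :: (real \<times> (real^'p)) measure)"
  and measurable_snd_borel [measurable]: "snd \<in> borel_measurable (borel :: (real \<times> (real^'p)) measure)"
  by (auto intro!: borel_measurable_continuous_onI continuous_intros)

lemma y_measurable [measurable]: "y \<in> borel_measurable M"
  and x_measurable [measurable]: "x \<in> borel_measurable M"
  using measurable_compose[OF W0_measurable measurable_fst_borel]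
    measurable_compose[OF W0_measurable measurable_snd_borel] by simp_all

lemma vec_nth_measurable [measurable]: "(\<lambda>v::real^'p. v $ j) \<in> borel_measurable borel"
  by (intro borel_measurable_continuous_onI continuous_intros)

lemma F_measurable [measurable]: "F \<in> borel_measurable borel"
  and loss_nu_measurable [measurable]: "loss_nu \<psi> \<in> borel_measurable borel"
  and nu'_measurable [measurable]: "nu' \<in> borel_measurable borel"
  by (intro borel_measurable_continuous_onI continuous_F continuous_loss_nu continuous_nu')+

lemma integrable_dominated:
  assumes "g \<in> borel_measurable M"
    and "\<And>\<omega>. \<omega> \<in> space M \<Longrightarrow> \<bar>g \<omega>\<bar> \<le> C * (w (x \<omega>) * (norm (x \<omega>))\<^sup>2)"
  shows "integrable M g"
  by (rule Bochner_Integration.integrable_bound[OF integrable_mult_right[OF second_moment, of C]])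
    (use assms order_trans[OF assms(2) abs_ge_self] in \<open>auto simp: mult.assoc\<close>)

text \<open>This is where the logistic model enters: given x the residual has mean zero, hence it is
  orthogonal to integrable functions of x. It centres the score (with \<open>nu\<close>) and removes
  the residual part of the Hessian (with \<open>nu'\<close>).\<close>

lemma expectation_residual:
  assumes [measurable]: "g \<in> borel_measurable borel" and int: "integrable M (\<lambda>\<omega>. g (x \<omega>))"
  shows "expectation (\<lambda>\<omega>. (y \<omega> - F (x \<omega> \<bullet> \<beta>\<^sub>0)) * g (x \<omega>)) = 0"
proof -
  define S where "S = vimage_algebra (space M) x borel"
  define ind where "ind = indicat_real {\<omega> \<in> space M. y \<omega> = 1}"
  have [measurable]: "ind \<in> borel_measurable M"
    unfolding ind_def by measurable
  have subalg: "subalgebra M S"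
    unfolding subalgebra_def S_def
    by (auto simp: sets_vimage_algebra2 intro: measurable_sets[OF x_measurable])
  interpret S: finite_measure_subalgebra M S
    by unfold_locales (rule subalg)
  \<comment> \<open>Measurability with respect to the sigma-algebra generated by x is what allows
    \<open>g (x \<omega>)\<close> to be moved past the conditional expectation.\<close>
  have gS: "(\<lambda>\<omega>. g (x \<omega>)) \<in> borel_measurable S"
    unfolding S_def by (rule measurable_compose[OF measurable_vimage_algebra1 assms(1)]) simp
  \<comment> \<open>The model is phrased for the event \<open>y = 1\<close>; since y takes only the
    values 0 and 1, its indicator is y itself.\<close>
  have ind_y: "ind \<omega> = y \<omega>" if "\<omega> \<in> space M" for \<omega>
    using y_01[OF that] that by (auto simp: ind_def)
  have y_le: "\<bar>y \<omega>\<bar> \<le> 1" if "\<omega> \<in> space M" for \<omega>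
    using y_01[OF that] by auto
  have int_y: "integrable M (\<lambda>\<omega>. g (x \<omega>) * y \<omega>)"
    by (rule Bochner_Integration.integrable_bound[OF int])
      (use y_le in \<open>auto simp: abs_mult intro!: mult_left_le\<close>)
  have int_F: "integrable M (\<lambda>\<omega>. g (x \<omega>) * F (x \<omega> \<bullet> \<beta>\<^sub>0))"
    by (rule Bochner_Integration.integrable_bound[OF int]) (auto simp: abs_mult intro!: mult_left_le)
  have int_ind: "integrable M (\<lambda>\<omega>. g (x \<omega>) * ind \<omega>)"
    using int_y Bochner_Integration.integrable_cong[OF refl, of M "\<lambda>\<omega>. g (x \<omega>) * ind \<omega>"] ind_y by simp
  have "expectation (\<lambda>\<omega>. g (x \<omega>) * F (x \<omega> \<bullet> \<beta>\<^sub>0)) = expectation (\<lambda>\<omega>. g (x \<omega>) * real_cond_exp M S ind \<omega>)"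
    using model by (intro integral_cong_AE) (auto simp: S_def ind_def)
  also have "\<dots> = expectation (\<lambda>\<omega>. g (x \<omega>) * ind \<omega>)"
    by (rule S.real_cond_exp_intg(2)[OF int_ind gS]) measurable
  also have "\<dots> = expectation (\<lambda>\<omega>. g (x \<omega>) * y \<omega>)"
    by (rule Bochner_Integration.integral_cong) (simp_all add: ind_y)
  finally show ?thesis
    using int_y int_F by (simp add: algebra_simps)
qed

section \<open>The matrix A and its quadratic form\<close>

definition curv :: "real^'p \<Rightarrow> real" where
  "curv v = F (v \<bullet> \<beta>\<^sub>0) * (1 - F (v \<bullet> \<beta>\<^sub>0)) * loss_nu \<psi> (v \<bullet> \<beta>\<^sub>0)"

definition hess :: "'p \<Rightarrow> 'p \<Rightarrow> real" where
  "hess j k = expectation (\<lambda>\<omega>. curv (x \<omega>) * w (x \<omega>) * (x \<omega> $ j) * (x \<omega> $ k))"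

text \<open>Coordinate j of the gradient at \<open>beta_0\<close> of the weighted loss of one
  observation \<open>z = (y, x)\<close>; \<open>hess_fun\<close> collects the second derivatives
  there.\<close>

definition score_fun :: "'p \<Rightarrow> real \<times> (real^'p) \<Rightarrow> real" where
  "score_fun j z = phi1 (fst z) (snd z \<bullet> \<beta>\<^sub>0) * w (snd z) * snd z $ j"

definition hess_fun :: "'p \<Rightarrow> 'p \<Rightarrow> real \<times> (real^'p) \<Rightarrow> real" where
  "hess_fun j k z = phi2 (fst z) (snd z \<bullet> \<beta>\<^sub>0) * w (snd z) * (snd z $ j) * (snd z $ k)"

definition loss_fun :: "real^'p \<Rightarrow> real \<times> (real^'p) \<Rightarrow> real" where
  "loss_fun \<beta> z = logistic_loss \<rho> \<psi> (fst z) (snd z \<bullet> \<beta>) * w (snd z)"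

definition emp_loss :: "nat \<Rightarrow> 'w \<Rightarrow> real^'p \<Rightarrow> real" where
  "emp_loss n \<omega> = empirical_loss \<rho> \<psi> w (\<lambda>i. ys i \<omega>) (\<lambda>i. xs i \<omega>) n"

lemma emp_loss_avg: "emp_loss n \<omega> \<beta> = avg (loss_fun \<beta>) n \<omega>"
  by (simp add: emp_loss_def empirical_loss_def avg_def loss_fun_def)

lemma curv_measurable [measurable]: "curv \<in> borel_measurable borel"
  and score_fun_measurable [measurable]: "score_fun j \<in> borel_measurable borel"
  and hess_fun_measurable [measurable]: "hess_fun j k \<in> borel_measurable borel"
  unfolding curv_def[abs_def] score_fun_def[abs_def] hess_fun_def[abs_def] phi1_def phi2_def
  by measurable

lemma curv_nonneg: "0 \<le> curv v"
  by (simp add: curv_def loss_nu_nonneg)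

text \<open>The restriction to responses 0 and 1 keeps the residual in [-1, 1]. The factor 2 is
  forced by \<open>phi2\<close>, a sum of two terms that are each at most \<open>B\<close>.\<close>

lemma bounds:
  obtains B where "0 < B" "\<And>t. \<bar>loss_nu \<psi> t\<bar> \<le> B" "\<And>v. \<bar>curv v\<bar> \<le> B"
    "\<And>t s. t \<in> {0, 1} \<Longrightarrow> \<bar>phi1 t s\<bar> \<le> B" "\<And>t s. t \<in> {0, 1} \<Longrightarrow> \<bar>phi2 t s\<bar> \<le> B"
proof -
  obtain B where B: "0 < B" "\<And>t. \<bar>loss_nu \<psi> t\<bar> \<le> B" "\<And>t. \<bar>nu' t\<bar> \<le> B"
    using loss_nu_nu'_bounded by blast
  have mult: "\<bar>a * b\<bar> \<le> B" if "\<bar>a\<bar> \<le> 1" "\<bar>b\<bar> \<le> B" for a b :: real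
    using mult_mono[OF that] by (simp add: abs_mult)
  have F1: "\<bar>F s * (1 - F s)\<bar> \<le> 1" for s
    by (simp add: abs_mult mult_le_one)
  have yF: "\<bar>t - F s\<bar> \<le> 1" if "t \<in> {0, 1}" for t s
    using that by auto
  show thesis
  proof (rule that[of "2 * B"])
    show "\<bar>loss_nu \<psi> t\<bar> \<le> 2 * B" for t
      using B(1) B(2)[of t] by linarith
    show "\<bar>curv v\<bar> \<le> 2 * B" for v
      unfolding curv_def using mult[OF F1 B(2), of "v \<bullet> \<beta>\<^sub>0" "v \<bullet> \<beta>\<^sub>0"] B(1) by linarith
    fix t s :: real assume t: "t \<in> {0, 1}"
    show "\<bar>phi1 t s\<bar> \<le> 2 * B"
      unfolding phi1_def mult_minus_left abs_minus_cancel
      using mult[OF yF[OF t] B(2), of s s] B(1) by linarith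
    show "\<bar>phi2 t s\<bar> \<le> 2 * B"
      unfolding phi2_def using mult[OF F1 B(2), of s s] mult[OF yF[OF t] B(3), of s s]
      by linarith
  qed (use B in simp)
qed

lemma abs_vec_nth_mult_le: "\<bar>(v $ j) * (v $ k)\<bar> \<le> (norm v)\<^sup>2" for v :: "real^'p"
  unfolding abs_mult power2_eq_square by (intro mult_mono component_le_norm_cart) auto

lemma weighted_le:
  assumes "\<bar>c\<bar> \<le> B" "\<bar>d\<bar> \<le> (norm v)\<^sup>2"
  shows "\<bar>c * w v * d\<bar> \<le> B * (w v * (norm v)\<^sup>2)"
  unfolding abs_mult mult.assoc using assms w_nonneg[of v]
  by (intro mult_mono) (auto intro: order_trans[of 0 "\<bar>c\<bar>"])

lemma integrable_curv:
  fixes d :: "real^'p \<Rightarrow> real"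
  assumes [measurable]: "d \<in> borel_measurable borel" and d: "\<And>v. \<bar>d v\<bar> \<le> C * (norm v)\<^sup>2"
  shows "integrable M (\<lambda>\<omega>. curv (x \<omega>) * w (x \<omega>) * d (x \<omega>))"
proof -
  obtain B where B: "0 < B" "\<And>v. \<bar>curv v\<bar> \<le> B"
    using bounds by metis
  show ?thesis
  proof (rule integrable_dominated[where C = "B * C"])
    fix \<omega>
    have "\<bar>curv (x \<omega>) * w (x \<omega>) * d (x \<omega>)\<bar> \<le> B * (w (x \<omega>) * (C * (norm (x \<omega>))\<^sup>2))"
      unfolding abs_mult mult.assoc using B d w_nonneg by (intro mult_mono) auto
    then show "\<bar>curv (x \<omega>) * w (x \<omega>) * d (x \<omega>)\<bar> \<le> B * C * (w (x \<omega>) * (norm (x \<omega>))\<^sup>2)"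
      by (simp add: algebra_simps)
  qed measurable
qed

lemma integrable_hess: "integrable M (\<lambda>\<omega>. curv (x \<omega>) * w (x \<omega>) * (x \<omega> $ j) * (x \<omega> $ k))"
  using integrable_curv[of "\<lambda>v. (v $ j) * (v $ k)" 1] abs_vec_nth_mult_le by (simp add: mult.assoc)

text \<open>Taking an entry is a bounded linear map and so commutes with the matrix-valued integral
  once the integrand is known to be integrable. For that, the norm of the outer product is bounded
  by the sum of its entries and then by the second moment.\<close>

lemma hessian_A_nth: "hessian_A M \<psi> w \<beta>\<^sub>0 x $ j $ k = hess j k"
proof -
  define m :: "real^'p \<Rightarrow> real^'p^'p" where "m v = (\<chi> i l. (v $ i) * (v $ l))" for v
  have m: "(columnvector v :: real^1^'p) ** rowvector v = m v" for v :: "real^'p"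
    by (simp add: m_def vec_eq_iff matrix_matrix_mult_def columnvector_def rowvector_def)
  have "continuous_on UNIV m"
    unfolding m_def[abs_def] by (intro continuous_on_vec_lambda continuous_intros)
  then have [measurable]: "m \<in> borel_measurable borel"
    by (rule borel_measurable_continuous_onI)
  have norm_m: "norm (m v) \<le> real CARD('p) * (real CARD('p) * (norm v)\<^sup>2)" for v
  proof -
    have "norm (m v) \<le> (\<Sum>i\<in>UNIV. norm (m v $ i))"
      unfolding norm_vec_def by (rule L2_set_le_sum) simp
    also have "\<dots> \<le> (\<Sum>i\<in>UNIV. \<Sum>l\<in>UNIV. \<bar>m v $ i $ l\<bar>)"
      by (intro sum_mono norm_le_l1_cart)
    also have "\<dots> \<le> (\<Sum>i\<in>(UNIV :: 'p set). \<Sum>l\<in>(UNIV :: 'p set). (norm v)\<^sup>2)"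
      unfolding m_def using abs_vec_nth_mult_le by (intro sum_mono) simp
    finally show ?thesis by simp
  qed
  have "integrable M (\<lambda>\<omega>. curv (x \<omega>) * w (x \<omega>) * norm (m (x \<omega>)))"
    by (rule integrable_curv[where C = "real CARD('p) * real CARD('p)"]) (use norm_m in \<open>simp_all add: mult.assoc\<close>)
  then have int: "integrable M (\<lambda>\<omega>. (curv (x \<omega>) * w (x \<omega>)) *\<^sub>R m (x \<omega>))"
    by (rule Bochner_Integration.integrable_bound) (auto simp: abs_mult)
  have "bounded_linear (\<lambda>A :: real^'p^'p. A $ j $ k)"
    by (rule bounded_linear_compose[OF bounded_linear_vec_nth bounded_linear_vec_nth])
  from integral_bounded_linear[OF this int] show ?thesis
    unfolding hessian_A_def hess_def m by (simp add: curv_def m_def mult.assoc)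
qed

definition quad :: "real^'p \<Rightarrow> real" where
  "quad u = (\<Sum>j\<in>UNIV. \<Sum>k\<in>UNIV. (u $ j) * (u $ k) * hess j k)"

text \<open>The coordinates of A u as expectations. With \<open>quad_eq\<close> they let
  \<open>quad_pos\<close> pass from a vanishing form to a vanishing product A u.\<close>

lemma sum_hess:
  "(\<Sum>k\<in>UNIV. hess j k * u $ k)
    = expectation (\<lambda>\<omega>. curv (x \<omega>) * w (x \<omega>) * ((x \<omega> $ j) * (x \<omega> \<bullet> u)))"
  and integrable_hess_mult:
  "integrable M (\<lambda>\<omega>. curv (x \<omega>) * w (x \<omega>) * ((x \<omega> $ j) * (x \<omega> \<bullet> u)))"
proof -
  have eq: "curv (x \<omega>) * w (x \<omega>) * ((x \<omega> $ j) * (x \<omega> \<bullet> u))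
      = (\<Sum>k\<in>UNIV. curv (x \<omega>) * w (x \<omega>) * (x \<omega> $ j) * (x \<omega> $ k) * u $ k)" for \<omega>
    by (simp add: inner_vec_def sum_distrib_left mult.assoc)
  show "(\<Sum>k\<in>UNIV. hess j k * u $ k)
    = expectation (\<lambda>\<omega>. curv (x \<omega>) * w (x \<omega>) * ((x \<omega> $ j) * (x \<omega> \<bullet> u)))"
    unfolding eq hess_def using integrable_hess by (simp add: Bochner_Integration.integral_sum)
  show "integrable M (\<lambda>\<omega>. curv (x \<omega>) * w (x \<omega>) * ((x \<omega> $ j) * (x \<omega> \<bullet> u)))"
    unfolding eq by (intro Bochner_Integration.integrable_sum integrable_mult_left integrable_hess)
qed

lemma quad_eq: "quad u = expectation (\<lambda>\<omega>. curv (x \<omega>) * w (x \<omega>) * (x \<omega> \<bullet> u)\<^sup>2)"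
  and integrable_quad: "integrable M (\<lambda>\<omega>. curv (x \<omega>) * w (x \<omega>) * (x \<omega> \<bullet> u)\<^sup>2)"
proof -
  have eq: "curv (x \<omega>) * w (x \<omega>) * (x \<omega> \<bullet> u)\<^sup>2
      = (\<Sum>j\<in>UNIV. u $ j * (curv (x \<omega>) * w (x \<omega>) * ((x \<omega> $ j) * (x \<omega> \<bullet> u))))" for \<omega>
  proof -
    have "(x \<omega> \<bullet> u)\<^sup>2 = (\<Sum>j\<in>UNIV. u $ j * ((x \<omega> $ j) * (x \<omega> \<bullet> u)))"
      unfolding power2_eq_square
      by (subst (1) inner_vec_def) (simp add: sum_distrib_left mult_ac)
    then show ?thesis
      by (simp add: sum_distrib_left algebra_simps)
  qed
  show "quad u = expectation (\<lambda>\<omega>. curv (x \<omega>) * w (x \<omega>) * (x \<omega> \<bullet> u)\<^sup>2)"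
    unfolding eq using integrable_hess_mult
    by (simp add: Bochner_Integration.integral_sum flip: sum_hess)
      (simp add: quad_def sum_distrib_left algebra_simps)
  show "integrable M (\<lambda>\<omega>. curv (x \<omega>) * w (x \<omega>) * (x \<omega> \<bullet> u)\<^sup>2)"
    unfolding eq
    by (intro Bochner_Integration.integrable_sum integrable_mult_right integrable_hess_mult)
qed

text \<open>A non-negative definite form that vanishes at \<open>u\<close> has \<open>u\<close> in the kernel of its matrix.\<close>

lemma quad_pos:
  assumes "u \<noteq> 0"
  shows "0 < quad u"
proof (rule ccontr)
  have nonneg: "0 \<le> curv v * w v * (v \<bullet> u)\<^sup>2" for v
    using curv_nonneg w_nonneg by simp
  assume "\<not> 0 < quad u"
  then have "expectation (\<lambda>\<omega>. curv (x \<omega>) * w (x \<omega>) * (x \<omega> \<bullet> u)\<^sup>2) = 0"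
    unfolding quad_eq using nonneg by (intro antisym integral_nonneg) auto
  then have "AE \<omega> in M. curv (x \<omega>) * w (x \<omega>) * (x \<omega> \<bullet> u)\<^sup>2 = 0"
    using integral_nonneg_eq_0_iff_AE[OF integrable_quad] nonneg by auto
  \<comment> \<open>A product that vanishes has a vanishing factor, and each of \<open>curv\<close>,
    \<open>w\<close> and \<open>x \<bullet> u\<close> is also a factor of the new integrand.\<close>
  then have "AE \<omega> in M. curv (x \<omega>) * w (x \<omega>) * ((x \<omega> $ j) * (x \<omega> \<bullet> u)) = 0" for j
    by (rule AE_mp) auto
  then have "(\<Sum>k\<in>UNIV. hess j k * u $ k) = 0" for j
    unfolding sum_hess by (intro integral_eq_zero_AE)
  then have "hessian_A M \<psi> w \<beta>\<^sub>0 x *v u = 0"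
    by (simp add: vec_eq_iff matrix_vector_mult_def hessian_A_nth)
  then show False
    using hessian_invertible assms matrix_left_invertible_ker unfolding invertible_def by blast
qed

text \<open>The constant is the minimum of the form on the unit sphere: attained by compactness,
  positive by \<open>quad_pos\<close>, and carried to all vectors by homogeneity of degree
  two.\<close>

lemma quad_lower_bound:
  obtains c where "0 < c" "\<And>u. c * (norm u)\<^sup>2 \<le> quad u"
proof -
  have "continuous_on (sphere 0 1) quad"
    unfolding quad_def[abs_def] by (intro continuous_intros)
  moreover have "sphere (0 :: real^'p) 1 \<noteq> {}"
    by simp
  ultimately obtain u0 where u0: "u0 \<in> sphere 0 1" "\<And>u. u \<in> sphere 0 1 \<Longrightarrow> quad u0 \<le> quad u"
    using continuous_attains_inf[of "sphere 0 1" quad] by auto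
  have scale: "quad (r *\<^sub>R u) = r\<^sup>2 * quad u" for r u
    by (simp add: quad_def sum_distrib_left power2_eq_square algebra_simps)
  have "quad u0 * (norm u)\<^sup>2 \<le> quad u" for u
  proof (cases "u = 0")
    case True
    then show ?thesis by (simp add: quad_def)
  next
    case False
    have "quad u0 \<le> quad (inverse (norm u) *\<^sub>R u)"
      using False by (intro u0(2)) simp
    then show ?thesis
      unfolding scale using False by (simp add: field_simps power_inverse)
  qed
  then show thesis
    using that[of "quad u0"] quad_pos[of u0] u0(1) by force
qed

section \<open>Moments of the score and Hessian summands\<close>

lemma score_mean: "expectation (\<lambda>\<omega>. score_fun j (y \<omega>, x \<omega>)) = 0"
proof -
  obtain B where B: "0 < B" "\<And>t. \<bar>loss_nu \<psi> t\<bar> \<le> B"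
    using bounds by metis
  let ?g = "\<lambda>v. - loss_nu \<psi> (v \<bullet> \<beta>\<^sub>0) * w v * v $ j"
  have "integrable M (\<lambda>\<omega>. ?g (x \<omega>))"
  proof (rule Bochner_Integration.integrable_bound)
    show "integrable M (\<lambda>\<omega>. B * (1 + w (x \<omega>) * (norm (x \<omega>))\<^sup>2))"
      using second_moment by simp
    have "\<bar>?g v\<bar> \<le> \<bar>B * (1 + w v * (norm v)\<^sup>2)\<bar>" for v
    proof -
      \<comment> \<open>The hypothesis controls \<open>w |x|^2\<close>, while the score only
        involves \<open>w |x|\<close>. With \<open>w <= 1\<close> this elementary inequality bounds
        the latter by \<open>1 + w |x|^2\<close>.\<close>
      have "norm v \<le> 1 + (norm v)\<^sup>2"
        using zero_le_power2[of "norm v - 1/2"] by (simp add: power2_eq_square algebra_simps)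
      then have "w v * norm v \<le> w v * (1 + (norm v)\<^sup>2)"
        using w_nonneg by (rule mult_left_mono)
      also have "\<dots> \<le> 1 + w v * (norm v)\<^sup>2"
        using w_le_1[of v] by (simp add: algebra_simps)
      finally have le: "w v * norm v \<le> 1 + w v * (norm v)\<^sup>2" .
      have "\<bar>?g v\<bar> = \<bar>loss_nu \<psi> (v \<bullet> \<beta>\<^sub>0)\<bar> * (w v * \<bar>v $ j\<bar>)"
        using w_nonneg[of v] by (simp add: abs_mult)
      also have "\<dots> \<le> B * (w v * norm v)"
        using B w_nonneg by (intro mult_mono mult_left_mono component_le_norm_cart) auto
      also have "\<dots> \<le> B * (1 + w v * (norm v)\<^sup>2)"
        using le B(1) by simp
      finally show ?thesis
        by (rule order_trans[OF _ abs_ge_self])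
    qed
    then show "AE \<omega> in M. norm (?g (x \<omega>)) \<le> norm (B * (1 + w (x \<omega>) * (norm (x \<omega>))\<^sup>2))"
      by simp
  qed measurable
  from expectation_residual[OF _ this]
  have "expectation (\<lambda>\<omega>. (y \<omega> - F (x \<omega> \<bullet> \<beta>\<^sub>0)) * ?g (x \<omega>)) = 0"
    by simp
  moreover have "score_fun j (y \<omega>, x \<omega>) = (y \<omega> - F (x \<omega> \<bullet> \<beta>\<^sub>0)) * ?g (x \<omega>)" for \<omega>
    by (simp add: score_fun_def phi1_def algebra_simps)
  ultimately show ?thesis
    by (simp only:)
qed

text \<open>Squaring the score produces \<open>w^2\<close>. One of the two factors is bounded by 1,
  so the weighted second moment is enough.\<close>

lemma score_square: "integrable M (\<lambda>\<omega>. (score_fun j (y \<omega>, x \<omega>))\<^sup>2)"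
proof -
  obtain B where B: "0 < B" "\<And>t s. t \<in> {0, 1} \<Longrightarrow> \<bar>phi1 t s\<bar> \<le> B"
    using bounds by metis
  show ?thesis
  proof (rule integrable_dominated)
    fix \<omega> assume \<omega>: "\<omega> \<in> space M"
    define v where "v = x \<omega>"
    have 1: "\<bar>w v * (v $ j)\<^sup>2\<bar> \<le> (norm v)\<^sup>2"
      using abs_vec_nth_mult_le[of v j j] mult_mono[OF w_le_1[of v] order_refl, of "(v $ j)\<^sup>2"] w_nonneg[of v]
      by (simp add: power2_eq_square)
    have 2: "\<bar>(phi1 (y \<omega>) (v \<bullet> \<beta>\<^sub>0))\<^sup>2\<bar> \<le> B\<^sup>2"
      using power_mono[OF B(2)[OF y_01[OF \<omega>]] abs_ge_zero, of _ 2] by simp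
    have "(score_fun j (y \<omega>, x \<omega>))\<^sup>2 = (phi1 (y \<omega>) (v \<bullet> \<beta>\<^sub>0))\<^sup>2 * w v * (w v * (v $ j)\<^sup>2)"
      by (simp add: score_fun_def v_def power_mult_distrib power2_eq_square mult_ac)
    then show "\<bar>(score_fun j (y \<omega>, x \<omega>))\<^sup>2\<bar> \<le> B\<^sup>2 * (w (x \<omega>) * (norm (x \<omega>))\<^sup>2)"
      using weighted_le[OF 2 1] by (simp only: v_def)
  qed measurable
qed

lemma hess_fun_integrable: "integrable M (\<lambda>\<omega>. hess_fun j k (y \<omega>, x \<omega>))"
proof -
  obtain B where B: "0 < B" "\<And>t s. t \<in> {0, 1} \<Longrightarrow> \<bar>phi2 t s\<bar> \<le> B"
    using bounds by metis
  show ?thesis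
  proof (rule integrable_dominated)
    fix \<omega> assume \<omega>: "\<omega> \<in> space M"
    show "\<bar>hess_fun j k (y \<omega>, x \<omega>)\<bar> \<le> B * (w (x \<omega>) * (norm (x \<omega>))\<^sup>2)"
      using weighted_le[OF B(2)[OF y_01[OF \<omega>]] abs_vec_nth_mult_le]
      by (simp add: hess_fun_def mult.assoc)
  qed measurable
qed

text \<open>The residual part of \<open>phi2\<close> integrates to zero by
  \<open>expectation_residual\<close>, and what remains is the integrand of A.\<close>

lemma hess_fun_mean: "expectation (\<lambda>\<omega>. hess_fun j k (y \<omega>, x \<omega>)) = hess j k"
proof -
  obtain B where B: "0 < B" "\<And>t. \<bar>nu' t\<bar> \<le> B"
    using loss_nu_nu'_bounded by metis
  let ?g = "\<lambda>v. nu' (v \<bullet> \<beta>\<^sub>0) * w v * ((v $ j) * (v $ k))"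
  have int: "integrable M (\<lambda>\<omega>. ?g (x \<omega>))"
    by (rule integrable_dominated[where C = B]) (use weighted_le[OF B(2) abs_vec_nth_mult_le] in auto)
  have split: "hess_fun j k (y \<omega>, x \<omega>) = curv (x \<omega>) * w (x \<omega>) * (x \<omega> $ j) * (x \<omega> $ k)
      - (y \<omega> - F (x \<omega> \<bullet> \<beta>\<^sub>0)) * ?g (x \<omega>)" for \<omega>
    by (simp add: hess_fun_def phi2_def curv_def algebra_simps)
  then have "(y \<omega> - F (x \<omega> \<bullet> \<beta>\<^sub>0)) * ?g (x \<omega>)
      = curv (x \<omega>) * w (x \<omega>) * (x \<omega> $ j) * (x \<omega> $ k) - hess_fun j k (y \<omega>, x \<omega>)" for \<omega>
    by simp
  then have "integrable M (\<lambda>\<omega>. (y \<omega> - F (x \<omega> \<bullet> \<beta>\<^sub>0)) * ?g (x \<omega>))"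
    using integrable_hess hess_fun_integrable by simp
  then show ?thesis
    unfolding split using expectation_residual[OF _ int] integrable_hess by (simp add: hess_def)
qed

section \<open>Second-order expansion with a remainder uniform in \<beta>\<close>

lemma phi2_uniformly_continuous:
  assumes "0 < \<eta>"
  obtains d where "0 < d"
    "\<And>t s s'. t \<in> {0, 1} \<Longrightarrow> \<bar>s\<bar> \<le> T \<Longrightarrow> \<bar>s'\<bar> \<le> T \<Longrightarrow> \<bar>s - s'\<bar> < d \<Longrightarrow> \<bar>phi2 t s - phi2 t s'\<bar> \<le> \<eta>"
proof -
  have "\<exists>d>0. \<forall>s s'. \<bar>s\<bar> \<le> T \<longrightarrow> \<bar>s'\<bar> \<le> T \<longrightarrow> \<bar>s - s'\<bar> < d \<longrightarrow> \<bar>phi2 t s - phi2 t s'\<bar> \<le> \<eta>" for t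
  proof -
    \<comment> \<open>Continuity of \<open>psi'\<close> yields uniform continuity on bounded
      intervals only. Later \<open>T\<close> is \<open>K * (norm \<beta>\<^sub>0 + 1)\<close>, which
      bounds \<open>x \<bullet> \<beta>\<close> for covariates of norm at most \<open>K\<close> and
      \<beta> within distance 1 of \<open>\<beta>\<^sub>0\<close>.\<close>
    have "uniformly_continuous_on {- T..T} (phi2 t)"
      by (intro compact_uniformly_continuous continuous_on_subset[OF continuous_phi2]) auto
    then obtain d where d: "0 < d"
      "\<And>s s'. s \<in> {- T..T} \<Longrightarrow> s' \<in> {- T..T} \<Longrightarrow> dist s s' < d \<Longrightarrow> dist (phi2 t s) (phi2 t s') < \<eta>"
      using \<open>0 < \<eta>\<close> unfolding uniformly_continuous_on_def by (metis dist_commute)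
    then have "\<bar>phi2 t s - phi2 t s'\<bar> \<le> \<eta>" if "\<bar>s\<bar> \<le> T" "\<bar>s'\<bar> \<le> T" "\<bar>s - s'\<bar> < d" for s s'
    proof -
      have "s \<in> {- T..T}" "s' \<in> {- T..T}"
        using that by auto
      then show ?thesis
        using d(2)[of s s'] that(3) by (simp add: dist_real_def)
    qed
    then show ?thesis
      using d(1) by blast
  qed
  then obtain d0 d1 where "0 < d0" "0 < d1"
    "\<And>s s'. \<bar>s\<bar> \<le> T \<Longrightarrow> \<bar>s'\<bar> \<le> T \<Longrightarrow> \<bar>s - s'\<bar> < d0 \<Longrightarrow> \<bar>phi2 0 s - phi2 0 s'\<bar> \<le> \<eta>"
    "\<And>s s'. \<bar>s\<bar> \<le> T \<Longrightarrow> \<bar>s'\<bar> \<le> T \<Longrightarrow> \<bar>s - s'\<bar> < d1 \<Longrightarrow> \<bar>phi2 1 s - phi2 1 s'\<bar> \<le> \<eta>"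
    by metis
  then show thesis
    by (intro that[of "min d0 d1"]) auto
qed

text \<open>Bounds twice the change caused by the shift of the second derivative, per unit of
  \<open>(norm h)\<^sup>2\<close>. It does not depend on \<open>h\<close>, so one event on which its
  average is small serves all directions and sizes at once.\<close>

definition rem_fun :: "real \<Rightarrow> real \<Rightarrow> nat \<Rightarrow> real \<times> (real^'p) \<Rightarrow> real" where
  "rem_fun B \<eta> K z = \<eta> * (w (snd z) * (norm (snd z))\<^sup>2)
    + 2 * B * (w (snd z) * (norm (snd z))\<^sup>2 * indicat_real {v. real K < norm v} (snd z))"

lemma rem_fun_measurable [measurable]: "rem_fun B \<eta> K \<in> borel_measurable borel"
  unfolding rem_fun_def[abs_def] by measurable

text \<open>Covariates in a fixed ball are handled by uniform continuity of \<open>phi2\<close>, the others by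
  boundedness of \<open>phi2\<close>; no measurability of a supremum over \<open>\<beta>\<close> is needed.\<close>

lemma loss_fun_lower_bound:
  assumes t: "t \<in> {0, 1}"
    and B: "\<And>s. \<bar>phi2 t s\<bar> \<le> B" and "0 \<le> \<eta>"
    and unif: "\<And>s s'. \<bar>s\<bar> \<le> real K * (norm \<beta>\<^sub>0 + 1) \<Longrightarrow> \<bar>s'\<bar> \<le> real K * (norm \<beta>\<^sub>0 + 1) \<Longrightarrow>
      \<bar>s - s'\<bar> < d \<Longrightarrow> \<bar>phi2 t s - phi2 t s'\<bar> \<le> \<eta>"
    and h: "norm h \<le> 1" "real K * norm h < d"
  shows "(\<Sum>j\<in>UNIV. h $ j * score_fun j (t, v))
      + 1 / 2 * (\<Sum>j\<in>UNIV. \<Sum>k\<in>UNIV. (h $ j) * (h $ k) * hess_fun j k (t, v))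
      - (norm h)\<^sup>2 / 2 * rem_fun B \<eta> K (t, v)
    \<le> loss_fun (\<beta>\<^sub>0 + h) (t, v) - loss_fun \<beta>\<^sub>0 (t, v)"
proof -
  define s0 where "s0 = v \<bullet> \<beta>\<^sub>0"
  define s1 where "s1 = v \<bullet> (\<beta>\<^sub>0 + h)"
  have s1: "s1 - s0 = v \<bullet> h"
    by (simp add: s0_def s1_def inner_add_right)
  obtain \<xi> where \<xi>: "\<bar>\<xi> - s0\<bar> \<le> \<bar>s1 - s0\<bar>"
    "logistic_loss \<rho> \<psi> t s1 = logistic_loss \<rho> \<psi> t s0 + phi1 t s0 * (s1 - s0) + phi2 t \<xi> / 2 * (s1 - s0)\<^sup>2"
    by (rule loss_Taylor)
  have score: "(\<Sum>j\<in>UNIV. h $ j * score_fun j (t, v)) = phi1 t s0 * w v * (v \<bullet> h)"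
    unfolding inner_vec_def[of v h] by (simp add: score_fun_def s0_def sum_distrib_left mult_ac)
  have hess: "(\<Sum>j\<in>UNIV. \<Sum>k\<in>UNIV. (h $ j) * (h $ k) * hess_fun j k (t, v)) = phi2 t s0 * w v * (v \<bullet> h)\<^sup>2"
    unfolding power2_eq_square inner_vec_def sum_product
    by (simp add: hess_fun_def s0_def sum_distrib_left mult_ac)
  have vh: "\<bar>v \<bullet> h\<bar> \<le> norm v * norm h"
    by (rule Cauchy_Schwarz_ineq2)
  have diff: "\<bar>phi2 t \<xi> - phi2 t s0\<bar> \<le> \<eta> + 2 * B * indicat_real {v. real K < norm v} v"
  proof (cases "real K < norm v")
    case True
    then show ?thesis
      using B[of \<xi>] B[of s0] \<open>0 \<le> \<eta>\<close> by simp
  next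
    case False
    have "norm v * norm h \<le> real K * norm h"
      using False by (intro mult_right_mono) auto
    then have *: "\<bar>\<xi> - s0\<bar> \<le> real K * norm h"
      using \<xi>(1) vh s1 by linarith
    have "\<bar>s0\<bar> \<le> norm v * norm \<beta>\<^sub>0"
      unfolding s0_def by (rule Cauchy_Schwarz_ineq2)
    also have "\<dots> \<le> real K * norm \<beta>\<^sub>0"
      using False by (intro mult_right_mono) auto
    finally have s0: "\<bar>s0\<bar> \<le> real K * norm \<beta>\<^sub>0" .
    \<comment> \<open>\<open>norm h \<le> 1\<close> is used to keep the intermediate point in the
      interval on which uniform continuity was granted.\<close>
    have "real K * norm h \<le> real K"
      using h(1) by (simp add: mult_left_le)
    then have "\<bar>\<xi>\<bar> \<le> real K * (norm \<beta>\<^sub>0 + 1)" "\<bar>s0\<bar> \<le> real K * (norm \<beta>\<^sub>0 + 1)"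
      using s0 * by (simp_all add: algebra_simps)
    then have "\<bar>phi2 t \<xi> - phi2 t s0\<bar> \<le> \<eta>"
      using * h(2) by (intro unif) auto
    then show ?thesis
      using False by simp
  qed
  have "\<bar>phi2 t \<xi> - phi2 t s0\<bar> * (w v * (v \<bullet> h)\<^sup>2)
      \<le> (\<eta> + 2 * B * indicat_real {v. real K < norm v} v) * (w v * ((norm v)\<^sup>2 * (norm h)\<^sup>2))"
  proof (intro mult_mono diff order_refl)
    show "(v \<bullet> h)\<^sup>2 \<le> (norm v)\<^sup>2 * (norm h)\<^sup>2"
      using power_mono[OF vh abs_ge_zero, of 2] by (simp add: power_mult_distrib)
    show "0 \<le> \<eta> + 2 * B * indicat_real {v. real K < norm v} v"
      using diff by linarith
  qed (use w_nonneg in auto)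
  also have "\<dots> = (norm h)\<^sup>2 * rem_fun B \<eta> K (t, v)"
    by (simp add: rem_fun_def algebra_simps)
  finally have "- ((phi2 t \<xi> - phi2 t s0) * (w v * (v \<bullet> h)\<^sup>2)) \<le> (norm h)\<^sup>2 * rem_fun B \<eta> K (t, v)"
    using mult_right_mono[OF abs_ge_minus_self, of "w v * (v \<bullet> h)\<^sup>2" "phi2 t \<xi> - phi2 t s0"] w_nonneg[of v]
    unfolding mult_minus_left by simp
  moreover have "loss_fun (\<beta>\<^sub>0 + h) (t, v) - loss_fun \<beta>\<^sub>0 (t, v)
      = phi1 t s0 * w v * (v \<bullet> h) + phi2 t \<xi> / 2 * (w v * (v \<bullet> h)\<^sup>2)"
    using \<xi>(2) unfolding s1 loss_fun_def fst_conv snd_conv s0_def[symmetric] s1_def[symmetric]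
    by (simp add: algebra_simps)
  ultimately show ?thesis
    unfolding score hess by (simp add: algebra_simps)
qed

lemma rem_fun_small:
  assumes "0 < \<epsilon>" "0 < B"
  obtains \<eta> K where "0 < \<eta>" "integrable M (\<lambda>\<omega>. rem_fun B \<eta> K (y \<omega>, x \<omega>))"
    "expectation (\<lambda>\<omega>. rem_fun B \<eta> K (y \<omega>, x \<omega>)) \<le> \<epsilon>"
proof -
  define m where "m = expectation (\<lambda>\<omega>. w (x \<omega>) * (norm (x \<omega>))\<^sup>2)"
  have "0 \<le> m"
    unfolding m_def using w_nonneg by (intro Bochner_Integration.integral_nonneg) auto
  \<comment> \<open>Half of the budget goes to the covariates inside the ball. The summand 1 keeps
    the denominator positive when \<open>m\<close> is 0.\<close>
  define \<eta> where "\<eta> = \<epsilon> / (2 * (m + 1))"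
  have \<eta>: "0 < \<eta>" "\<eta> * m \<le> \<epsilon> / 2"
    using \<open>0 \<le> m\<close> \<open>0 < \<epsilon>\<close> by (auto simp: \<eta>_def field_simps add_pos_nonneg)
  \<comment> \<open>The other half: the tail enters \<open>rem_fun\<close> with coefficient
    \<open>2 * B\<close>.\<close>
  have "0 < \<epsilon> / (4 * B)"
    using assms by simp
  then obtain K where K: "expectation (\<lambda>\<omega>. \<bar>w (x \<omega>) * (norm (x \<omega>))\<^sup>2\<bar>
      * indicat_real {\<omega>. real K < norm (x \<omega>)} \<omega>) \<le> \<epsilon> / (4 * B)"
    by (rule integrable_tail[OF second_moment, of "\<lambda>\<omega>. norm (x \<omega>)", rotated]) auto
  have eq: "\<bar>w (x \<omega>) * (norm (x \<omega>))\<^sup>2\<bar> * indicat_real {\<omega>. real K < norm (x \<omega>)} \<omega>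
      = w (x \<omega>) * (norm (x \<omega>))\<^sup>2 * indicat_real {v. real K < norm v} (x \<omega>)" for \<omega>
    using w_nonneg by (simp add: indicator_def)
  have int: "integrable M (\<lambda>\<omega>. w (x \<omega>) * (norm (x \<omega>))\<^sup>2 * indicat_real {v. real K < norm v} (x \<omega>))"
    by (rule integrable_dominated[where C = 1]) (use w_nonneg in \<open>auto simp: indicator_def\<close>)
  show thesis
  proof (rule that[OF \<eta>(1)])
    show "integrable M (\<lambda>\<omega>. rem_fun B \<eta> K (y \<omega>, x \<omega>))"
      unfolding rem_fun_def snd_conv
      by (intro Bochner_Integration.integrable_add integrable_mult_right second_moment int)
    have "expectation (\<lambda>\<omega>. rem_fun B \<eta> K (y \<omega>, x \<omega>)) = \<eta> * m
      + 2 * B * expectation (\<lambda>\<omega>. w (x \<omega>) * (norm (x \<omega>))\<^sup>2 * indicat_real {v. real K < norm v} (x \<omega>))"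
      unfolding rem_fun_def snd_conv m_def using second_moment int by simp
    also have "2 * B * expectation (\<lambda>\<omega>. w (x \<omega>) * (norm (x \<omega>))\<^sup>2 * indicat_real {v. real K < norm v} (x \<omega>))
        \<le> 2 * B * (\<epsilon> / (4 * B))"
      using K unfolding eq using \<open>0 < B\<close> by (intro mult_left_mono) auto
    also have "2 * B * (\<epsilon> / (4 * B)) = \<epsilon> / 2"
      using \<open>0 < B\<close> by simp
    finally show "expectation (\<lambda>\<omega>. rem_fun B \<eta> K (y \<omega>, x \<omega>)) \<le> \<epsilon>"
      using \<eta>(2) by simp
  qed
qed

text \<open>A deterministic statement at one sample point. Sampling error takes c / 4 from the
  Hessian form and the remainder takes another c / 4; half of the c / 2 that is left is the final
  coefficient c / 4.\<close>

lemma emp_loss_lower_bound: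
  assumes B: "\<And>t s. t \<in> {0, 1} \<Longrightarrow> \<bar>phi2 t s\<bar> \<le> B" and "0 \<le> \<eta>"
    and unif: "\<And>t s s'. t \<in> {0, 1} \<Longrightarrow> \<bar>s\<bar> \<le> real K * (norm \<beta>\<^sub>0 + 1) \<Longrightarrow> \<bar>s'\<bar> \<le> real K * (norm \<beta>\<^sub>0 + 1) \<Longrightarrow>
      \<bar>s - s'\<bar> < d \<Longrightarrow> \<bar>phi2 t s - phi2 t s'\<bar> \<le> \<eta>"
    and c: "\<And>u. c * (norm u)\<^sup>2 \<le> quad u"
    and score: "\<And>j. \<bar>avg (score_fun j) n \<omega>\<bar> \<le> S"
    and hess: "\<And>j k. \<bar>avg (hess_fun j k) n \<omega> - hess j k\<bar> \<le> c / (4 * (real CARD('p))\<^sup>2)"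
    and rem: "avg (rem_fun B \<eta> K) n \<omega> \<le> c / 4"
    and \<omega>: "\<omega> \<in> space M"
    and h: "norm h \<le> 1" "real K * norm h < d"
  shows "c / 4 * (norm h)\<^sup>2 - real CARD('p) * S * norm h \<le> emp_loss n \<omega> (\<beta>\<^sub>0 + h) - emp_loss n \<omega> \<beta>\<^sub>0"
proof -
  define p where "p = real CARD('p)"
  have "0 < p"
    by (simp add: p_def)
  have "avg (\<lambda>z. (\<Sum>j\<in>UNIV. h $ j * score_fun j z)
      + 1 / 2 * (\<Sum>j\<in>UNIV. \<Sum>k\<in>UNIV. (h $ j) * (h $ k) * hess_fun j k z)
      - (norm h)\<^sup>2 / 2 * rem_fun B \<eta> K z) n \<omega>
    \<le> avg (\<lambda>z. loss_fun (\<beta>\<^sub>0 + h) z - loss_fun \<beta>\<^sub>0 z) n \<omega>"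
  proof (rule avg_mono)
    fix i :: nat assume "1 \<le> i"
    then have t: "ys i \<omega> \<in> {0, 1}"
      using ys_01 \<omega> by blast
    show "(\<Sum>j\<in>UNIV. h $ j * score_fun j (ys i \<omega>, xs i \<omega>))
      + 1 / 2 * (\<Sum>j\<in>UNIV. \<Sum>k\<in>UNIV. (h $ j) * (h $ k) * hess_fun j k (ys i \<omega>, xs i \<omega>))
      - (norm h)\<^sup>2 / 2 * rem_fun B \<eta> K (ys i \<omega>, xs i \<omega>)
      \<le> loss_fun (\<beta>\<^sub>0 + h) (ys i \<omega>, xs i \<omega>) - loss_fun \<beta>\<^sub>0 (ys i \<omega>, xs i \<omega>)"
      by (rule loss_fun_lower_bound[OF t B[OF t] \<open>0 \<le> \<eta>\<close> unif[OF t] h])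
  qed
  then have main: "(\<Sum>j\<in>UNIV. h $ j * avg (score_fun j) n \<omega>)
      + 1 / 2 * (\<Sum>j\<in>UNIV. \<Sum>k\<in>UNIV. (h $ j) * (h $ k) * avg (hess_fun j k) n \<omega>)
      - (norm h)\<^sup>2 / 2 * avg (rem_fun B \<eta> K) n \<omega>
    \<le> emp_loss n \<omega> (\<beta>\<^sub>0 + h) - emp_loss n \<omega> \<beta>\<^sub>0"
    by (simp only: avg_add avg_diff avg_sum avg_cmult emp_loss_avg)
  have "\<bar>\<Sum>j\<in>UNIV. h $ j * avg (score_fun j) n \<omega>\<bar> \<le> (\<Sum>j\<in>(UNIV :: 'p set). norm h * S)"
    by (rule order_trans[OF sum_abs sum_mono])
      (use score component_le_norm_cart in \<open>auto simp: abs_mult intro!: mult_mono\<close>)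
  then have 1: "- (p * S * norm h) \<le> (\<Sum>j\<in>UNIV. h $ j * avg (score_fun j) n \<omega>)"
    by (simp add: p_def algebra_simps abs_le_iff)
  define E where "E j k = avg (hess_fun j k) n \<omega> - hess j k" for j k
  \<comment> \<open>The tolerance \<open>c / (4 * p\<^sup>2)\<close> per entry is chosen so that all
    \<open>p\<^sup>2\<close> entries together cost c / 4.\<close>
  have "\<bar>\<Sum>j\<in>UNIV. \<Sum>k\<in>UNIV. (h $ j) * (h $ k) * E j k\<bar>
      \<le> (\<Sum>j\<in>(UNIV :: 'p set). \<Sum>k\<in>(UNIV :: 'p set). (norm h)\<^sup>2 * (c / (4 * p\<^sup>2)))"
  proof (intro order_trans[OF sum_abs] sum_mono)
    fix j k
    show "\<bar>(h $ j) * (h $ k) * E j k\<bar> \<le> (norm h)\<^sup>2 * (c / (4 * p\<^sup>2))"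
      unfolding abs_mult[of "(h $ j) * (h $ k)"]
      using abs_vec_nth_mult_le hess unfolding E_def p_def by (intro mult_mono) auto
  qed
  also have "\<dots> = c / 4 * (norm h)\<^sup>2"
    using \<open>0 < p\<close> by (simp add: p_def[symmetric] field_simps power2_eq_square)
  finally have "- (c / 4 * (norm h)\<^sup>2) \<le> (\<Sum>j\<in>UNIV. \<Sum>k\<in>UNIV. (h $ j) * (h $ k) * E j k)"
    by (simp add: abs_le_iff)
  moreover have "(\<Sum>j\<in>UNIV. \<Sum>k\<in>UNIV. (h $ j) * (h $ k) * avg (hess_fun j k) n \<omega>)
      = quad h + (\<Sum>j\<in>UNIV. \<Sum>k\<in>UNIV. (h $ j) * (h $ k) * E j k)"
    by (simp add: quad_def E_def sum.distrib[symmetric] algebra_simps)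
  ultimately have 2: "3 / 4 * c * (norm h)\<^sup>2
      \<le> (\<Sum>j\<in>UNIV. \<Sum>k\<in>UNIV. (h $ j) * (h $ k) * avg (hess_fun j k) n \<omega>)"
    using c[of h] by (simp add: algebra_simps)
  have 3: "(norm h)\<^sup>2 / 2 * avg (rem_fun B \<eta> K) n \<omega> \<le> (norm h)\<^sup>2 / 2 * (c / 4)"
    using rem by (intro mult_left_mono) auto
  show ?thesis
    using main 1 2 3 unfolding p_def[symmetric] by (simp add: algebra_simps)
qed

text \<open>The curvature is a quarter of the lower bound of \<open>quad\<close> and so does not
  depend on \<epsilon>; only the radius and \<open>C\<close> do. The exceptional event precedes the
  quantifier over \<beta>, which is what permits inserting the random estimator.\<close>

lemma quadratic_lower_bound:
  "\<exists>c>0. \<forall>\<epsilon>>0. \<exists>\<eta>>0. \<exists>C>0. \<forall>\<^sub>F n in sequentially. \<exists>E\<in>events. prob E \<le> \<epsilon> \<and>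
    (\<forall>\<omega>\<in>space M - E. \<forall>\<beta>. norm (\<beta> - \<beta>\<^sub>0) \<le> \<eta> \<longrightarrow>
      c * (norm (\<beta> - \<beta>\<^sub>0))\<^sup>2 - C / sqrt (real n) * norm (\<beta> - \<beta>\<^sub>0)
        \<le> emp_loss n \<omega> \<beta> - emp_loss n \<omega> \<beta>\<^sub>0)"
proof -
  obtain c where c: "0 < c" "\<And>u. c * (norm u)\<^sup>2 \<le> quad u"
    using quad_lower_bound by blast
  obtain B where B: "0 < B" "\<And>t s. t \<in> {0, 1} \<Longrightarrow> \<bar>phi2 t s\<bar> \<le> B"
    using bounds by metis
  define p where "p = real CARD('p)"
  have p: "0 < p"
    by (simp add: p_def)
  have "\<exists>\<eta>>0. \<exists>C>0. \<forall>\<^sub>F n in sequentially. \<exists>E\<in>events. prob E \<le> \<epsilon> \<and>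
    (\<forall>\<omega>\<in>space M - E. \<forall>\<beta>. norm (\<beta> - \<beta>\<^sub>0) \<le> \<eta> \<longrightarrow>
      c / 4 * (norm (\<beta> - \<beta>\<^sub>0))\<^sup>2 - C / sqrt (real n) * norm (\<beta> - \<beta>\<^sub>0)
        \<le> emp_loss n \<omega> \<beta> - emp_loss n \<omega> \<beta>\<^sub>0)"
    if "0 < \<epsilon>" for \<epsilon>
  proof -
    \<comment> \<open>With this mean, Markov's inequality at level c / 4 bounds the probability of a
      large remainder by \<epsilon> / 3.\<close>
    have "0 < \<epsilon> / 3 * (c / 4)"
      using \<open>0 < \<epsilon>\<close> c by simp
    from rem_fun_small[OF this B(1)] obtain \<eta> K where \<eta>: "0 < \<eta>"
      and rem_int: "integrable M (\<lambda>\<omega>. rem_fun B \<eta> K (y \<omega>, x \<omega>))"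
      and rem_le: "expectation (\<lambda>\<omega>. rem_fun B \<eta> K (y \<omega>, x \<omega>)) \<le> \<epsilon> / 3 * (c / 4)"
      by blast
    obtain d where d: "0 < d" "\<And>t s s'. t \<in> {0, 1} \<Longrightarrow> \<bar>s\<bar> \<le> real K * (norm \<beta>\<^sub>0 + 1) \<Longrightarrow>
        \<bar>s'\<bar> \<le> real K * (norm \<beta>\<^sub>0 + 1) \<Longrightarrow> \<bar>s - s'\<bar> < d \<Longrightarrow> \<bar>phi2 t s - phi2 t s'\<bar> \<le> \<eta>"
      using phi2_uniformly_continuous[OF \<eta>, of "real K * (norm \<beta>\<^sub>0 + 1)"] by metis
    \<comment> \<open>The radius has to satisfy both \<open>r \<le> 1\<close> and
      \<open>K * r < d\<close>; \<open>K + 1\<close> avoids a zero denominator.\<close>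
    define r where "r = min 1 (d / (2 * (real K + 1)))"
    have r: "0 < r" "r \<le> 1" "real K * r < d"
    proof -
      show "0 < r" "r \<le> 1"
        using d(1) by (auto simp: r_def)
      have "real K * r \<le> (real K + 1) * (d / (2 * (real K + 1)))"
        unfolding r_def using d(1) by (intro mult_mono) auto
      also have "\<dots> < d"
        using d(1) by (simp add: field_simps add_pos_nonneg)
      finally show "real K * r < d" .
    qed
    define V where "V = (\<Sum>j\<in>UNIV. expectation (\<lambda>\<omega>. (score_fun j (y \<omega>, x \<omega>))\<^sup>2))"
    have V: "0 \<le> expectation (\<lambda>\<omega>. (score_fun j (y \<omega>, x \<omega>))\<^sup>2)" for j
      by (rule Bochner_Integration.integral_nonneg) simp
    then have "0 \<le> V"
      unfolding V_def by (intro sum_nonneg)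
    \<comment> \<open>Chosen so that the Chebyshev bounds, summed over the coordinates of the score,
      give \<open>V / C\<^sup>2 \<le> \<epsilon> / 3\<close>; \<open>V + 1\<close> makes
      \<open>C\<close> positive.\<close>
    define C where "C = sqrt (3 * (V + 1) / \<epsilon>)"
    have C: "0 < C" "C\<^sup>2 = 3 * (V + 1) / \<epsilon>"
      using \<open>0 \<le> V\<close> \<open>0 < \<epsilon>\<close> by (auto simp: C_def add_nonneg_pos)
    define \<kappa> where "\<kappa> = c / (4 * p\<^sup>2)"
    have \<kappa>: "0 < \<kappa>"
      using c p by (simp add: \<kappa>_def)
    \<comment> \<open>Each of the \<open>p\<^sup>2\<close> Hessian entries receives an equal share
      of \<epsilon> / 3.\<close>
    have \<epsilon>': "0 < \<epsilon> / (3 * p\<^sup>2)"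
      using \<open>0 < \<epsilon>\<close> p by simp
    define E1 where "E1 n j = {\<omega> \<in> space M. C / sqrt (real n) \<le> \<bar>avg (score_fun j) n \<omega>\<bar>}" for n j
    define E2 where "E2 n jk = {\<omega> \<in> space M. \<kappa> \<le> \<bar>avg (hess_fun (fst jk) (snd jk)) n \<omega>
      - hess (fst jk) (snd jk)\<bar>}" for n jk
    define E3 where "E3 n = {\<omega> \<in> space M. c / 4 \<le> avg (rem_fun B \<eta> K) n \<omega>}" for n
    have [measurable]: "E1 n j \<in> events" "E2 n jk \<in> events" "E3 n \<in> events" for n j jk
      unfolding E1_def E2_def E3_def by measurable
    have ev: "\<forall>\<^sub>F n in sequentially. \<forall>jk. prob (E2 n jk) \<le> \<epsilon> / (3 * p\<^sup>2)"
    proof (rule eventually_all_finite)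
      fix jk :: "'p \<times> 'p"
      show "\<forall>\<^sub>F n in sequentially. prob (E2 n jk) \<le> \<epsilon> / (3 * p\<^sup>2)"
        unfolding E2_def hess_fun_mean[symmetric]
        by (rule weak_law_of_large_numbers[OF hess_fun_measurable hess_fun_integrable \<kappa> \<epsilon>'])
    qed
    have main: "\<exists>E\<in>events. prob E \<le> \<epsilon> \<and>
      (\<forall>\<omega>\<in>space M - E. \<forall>\<beta>. norm (\<beta> - \<beta>\<^sub>0) \<le> r \<longrightarrow>
        c / 4 * (norm (\<beta> - \<beta>\<^sub>0))\<^sup>2 - (p * C) / sqrt (real n) * norm (\<beta> - \<beta>\<^sub>0)
          \<le> emp_loss n \<omega> \<beta> - emp_loss n \<omega> \<beta>\<^sub>0)"
      if n: "1 \<le> n" and E2: "\<forall>jk. prob (E2 n jk) \<le> \<epsilon> / (3 * p\<^sup>2)" for n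
    proof -
      define E where "E = (\<Union>j\<in>UNIV. E1 n j) \<union> (\<Union>jk\<in>UNIV. E2 n jk) \<union> E3 n"
      have E: "E \<in> events"
        unfolding E_def by measurable
      have "prob (E1 n j) \<le> expectation (\<lambda>\<omega>. (score_fun j (y \<omega>, x \<omega>))\<^sup>2) / (real n * (C / sqrt (real n))\<^sup>2)" for j
        unfolding E1_def
        by (rule avg_Chebyshev[OF score_fun_measurable score_square score_mean]) (use n C in auto)
      \<comment> \<open>The sample size cancels: at threshold \<open>C / sqrt n\<close> the
        Chebyshev bound is the same for all n.\<close>
      then have P1: "prob (E1 n j) \<le> expectation (\<lambda>\<omega>. (score_fun j (y \<omega>, x \<omega>))\<^sup>2) / C\<^sup>2" for j
        using n by (simp add: power_divide)
      have "prob (\<Union>j\<in>UNIV. E1 n j) \<le> (\<Sum>j\<in>UNIV. prob (E1 n j))"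
        by (rule measure_UNION_le) auto
      also have "\<dots> \<le> (\<Sum>j\<in>UNIV. expectation (\<lambda>\<omega>. (score_fun j (y \<omega>, x \<omega>))\<^sup>2) / C\<^sup>2)"
        by (intro sum_mono P1)
      also have "\<dots> = V / C\<^sup>2"
        by (simp add: V_def sum_divide_distrib)
      also have "\<dots> \<le> \<epsilon> / 3"
        unfolding C(2) using \<open>0 \<le> V\<close> \<open>0 < \<epsilon>\<close> by (simp add: field_simps)
      finally have P1: "prob (\<Union>j\<in>UNIV. E1 n j) \<le> \<epsilon> / 3" .
      have "prob (\<Union>jk\<in>UNIV. E2 n jk) \<le> (\<Sum>jk\<in>UNIV. prob (E2 n jk))"
        by (rule measure_UNION_le) auto
      also have "\<dots> \<le> (\<Sum>jk\<in>(UNIV :: ('p \<times> 'p) set). \<epsilon> / (3 * p\<^sup>2))"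
        using E2 by (intro sum_mono) blast
      also have "\<dots> = \<epsilon> / 3"
        using p by (simp add: p_def power2_eq_square field_simps)
      finally have P2: "prob (\<Union>jk\<in>UNIV. E2 n jk) \<le> \<epsilon> / 3" .
      have "prob (E3 n) \<le> expectation (\<lambda>\<omega>. rem_fun B \<eta> K (y \<omega>, x \<omega>)) / (c / 4)"
        unfolding E3_def
      proof (rule avg_Markov[OF rem_fun_measurable rem_int])
        show "0 \<le> rem_fun B \<eta> K z" for z
          unfolding rem_fun_def using w_nonneg B(1) \<eta> by (intro add_nonneg_nonneg mult_nonneg_nonneg) auto
      qed (use n c in auto)
      also have "\<dots> \<le> \<epsilon> / 3"
        using rem_le c(1) by (simp add: field_simps)
      finally have P3: "prob (E3 n) \<le> \<epsilon> / 3" .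
      have "prob E \<le> prob ((\<Union>j\<in>UNIV. E1 n j) \<union> (\<Union>jk\<in>UNIV. E2 n jk)) + prob (E3 n)"
        unfolding E_def by (rule measure_Un_le) measurable
      moreover have "prob ((\<Union>j\<in>UNIV. E1 n j) \<union> (\<Union>jk\<in>UNIV. E2 n jk))
          \<le> prob (\<Union>j\<in>UNIV. E1 n j) + prob (\<Union>jk\<in>UNIV. E2 n jk)"
        by (rule measure_Un_le) measurable
      ultimately have "prob E \<le> \<epsilon>"
        using P1 P2 P3 by linarith
      moreover have "c / 4 * (norm (\<beta> - \<beta>\<^sub>0))\<^sup>2 - (p * C) / sqrt (real n) * norm (\<beta> - \<beta>\<^sub>0)
          \<le> emp_loss n \<omega> \<beta> - emp_loss n \<omega> \<beta>\<^sub>0"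
        if \<omega>: "\<omega> \<in> space M - E" and \<beta>: "norm (\<beta> - \<beta>\<^sub>0) \<le> r" for \<omega> \<beta>
      proof -
        have score: "\<bar>avg (score_fun j) n \<omega>\<bar> \<le> C / sqrt (real n)" for j
        proof -
          have "\<omega> \<notin> E1 n j"
            using \<omega> unfolding E_def by blast
          then show ?thesis
            using \<omega> unfolding E1_def by auto
        qed
        have hess: "\<bar>avg (hess_fun j k) n \<omega> - hess j k\<bar> \<le> c / (4 * (real CARD('p))\<^sup>2)" for j k
        proof -
          have "\<omega> \<notin> E2 n (j, k)"
            using \<omega> unfolding E_def by blast
          then show ?thesis
            using \<omega> unfolding E2_def \<kappa>_def p_def by auto
        qed
        have rem: "avg (rem_fun B \<eta> K) n \<omega> \<le> c / 4"
          using \<omega> unfolding E_def E3_def by auto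
        have K: "real K * norm (\<beta> - \<beta>\<^sub>0) < d"
          using mult_left_mono[OF \<beta>, of "real K"] r(3) by simp
        have "c / 4 * (norm (\<beta> - \<beta>\<^sub>0))\<^sup>2 - real CARD('p) * (C / sqrt (real n)) * norm (\<beta> - \<beta>\<^sub>0)
          \<le> emp_loss n \<omega> (\<beta>\<^sub>0 + (\<beta> - \<beta>\<^sub>0)) - emp_loss n \<omega> \<beta>\<^sub>0"
          by (rule emp_loss_lower_bound[OF B(2) _ d(2) c(2) score hess rem]) (use \<omega> \<beta> r K \<eta> in auto)
        then show ?thesis
          by (simp add: p_def)
      qed
      ultimately show ?thesis
        using E by blast
    qed
    have "\<forall>\<^sub>F n in sequentially. \<exists>E\<in>events. prob E \<le> \<epsilon> \<and>
      (\<forall>\<omega>\<in>space M - E. \<forall>\<beta>. norm (\<beta> - \<beta>\<^sub>0) \<le> r \<longrightarrow>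
        c / 4 * (norm (\<beta> - \<beta>\<^sub>0))\<^sup>2 - (p * C) / sqrt (real n) * norm (\<beta> - \<beta>\<^sub>0)
          \<le> emp_loss n \<omega> \<beta> - emp_loss n \<omega> \<beta>\<^sub>0)"
      using ev eventually_ge_at_top[of 1] by eventually_elim (rule main)
    moreover have "0 < p * C"
      using p C by simp
    ultimately show ?thesis
      using r(1) by blast
  qed
  then show ?thesis
    using c(1) by (intro exI[of _ "c / 4"]) auto
qed

end


section \<open>Rates of convergence\<close>

text \<open>Every subset of the space has a measurable cover of the same outer measure, and the
  union of two covers covers the union.\<close>

lemma outer_measure_of_subadditive:
  assumes "A \<subseteq> space M" "B \<subseteq> space M"
  shows "outer_measure_of M (A \<union> B) \<le> outer_measure_of M A + outer_measure_of M B"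
proof -
  obtain A' B' where *: "A' \<in> sets M" "A \<subseteq> A'" "outer_measure_of M A = emeasure M A'"
    "B' \<in> sets M" "B \<subseteq> B'" "outer_measure_of M B = emeasure M B'"
    using outer_measure_of_attain assms by metis
  have "outer_measure_of M (A \<union> B) \<le> outer_measure_of M (A' \<union> B')"
    using * by (intro outer_measure_of_mono) blast
  also have "\<dots> \<le> emeasure M A' + emeasure M B'"
    using * by (simp add: emeasure_subadditive)
  finally show ?thesis
    using * by simp
qed

lemma outer_measure_of_Un_le:
  assumes "C \<subseteq> A \<union> B" "A \<subseteq> space M" "B \<subseteq> space M"
    and "outer_measure_of M A \<le> ennreal a" "outer_measure_of M B \<le> ennreal b" "0 \<le> a" "0 \<le> b"
  shows "outer_measure_of M C \<le> ennreal (a + b)"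
proof -
  have "outer_measure_of M C \<le> outer_measure_of M (A \<union> B)"
    by (rule outer_measure_of_mono) fact
  also have "\<dots> \<le> ennreal a + ennreal b"
    using outer_measure_of_subadditive[of A M B] assms(2-5) by (meson add_mono order_trans)
  finally show ?thesis
    using assms by simp
qed

lemma eventually_le_ennreal:
  fixes f :: "nat \<Rightarrow> ennreal"
  assumes "f \<longlonglongrightarrow> 0" "0 < \<epsilon>"
  shows "\<forall>\<^sub>F n in sequentially. f n \<le> ennreal \<epsilon>"
  using order_tendstoD(2)[OF assms(1), of "ennreal \<epsilon>"] assms(2)
  by (auto elim: eventually_mono)

text \<open>Both special cases of (a) replace the rate \<open>lam + 1 / sqrt n\<close> by one of its
  summands, which dominates it up to a constant with probability close to one.\<close>

lemma bigO_in_probability_trans: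
  assumes Z: "bigO_in_probability M Z r"
    and r: "\<And>\<epsilon>. 0 < \<epsilon> \<Longrightarrow> \<exists>D>0. \<forall>\<^sub>F n in sequentially.
      outer_measure_of M {\<omega> \<in> space M. D * s n \<omega> < r n \<omega>} \<le> ennreal \<epsilon>"
  shows "bigO_in_probability M Z s"
  unfolding bigO_in_probability_def
proof (intro allI impI)
  fix \<epsilon> :: real assume "0 < \<epsilon>"
  then have "0 < \<epsilon> / 2"
    by simp
  obtain C where C: "0 < C" "\<forall>\<^sub>F n in sequentially.
      outer_measure_of M {\<omega> \<in> space M. C * r n \<omega> < \<bar>Z n \<omega>\<bar>} \<le> ennreal (\<epsilon> / 2)"
    using Z \<open>0 < \<epsilon> / 2\<close> unfolding bigO_in_probability_def by blast
  obtain D where D: "0 < D" "\<forall>\<^sub>F n in sequentially.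
      outer_measure_of M {\<omega> \<in> space M. D * s n \<omega> < r n \<omega>} \<le> ennreal (\<epsilon> / 2)"
    using r[OF \<open>0 < \<epsilon> / 2\<close>] by blast
  have "\<forall>\<^sub>F n in sequentially. outer_measure_of M {\<omega> \<in> space M. C * D * s n \<omega> < \<bar>Z n \<omega>\<bar>} \<le> ennreal \<epsilon>"
    using C(2) D(2)
  proof eventually_elim
    case (elim n)
    have "{\<omega> \<in> space M. C * D * s n \<omega> < \<bar>Z n \<omega>\<bar>}
        \<subseteq> {\<omega> \<in> space M. C * r n \<omega> < \<bar>Z n \<omega>\<bar>} \<union> {\<omega> \<in> space M. D * s n \<omega> < r n \<omega>}"
    proof
      fix \<omega> assume \<omega>: "\<omega> \<in> {\<omega> \<in> space M. C * D * s n \<omega> < \<bar>Z n \<omega>\<bar>}"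
      show "\<omega> \<in> {\<omega> \<in> space M. C * r n \<omega> < \<bar>Z n \<omega>\<bar>} \<union> {\<omega> \<in> space M. D * s n \<omega> < r n \<omega>}"
      proof (cases "D * s n \<omega> < r n \<omega>")
        case False
        then have "C * r n \<omega> \<le> C * D * s n \<omega>"
          using \<open>0 < C\<close> by (simp add: mult.assoc)
        then show ?thesis
          using \<omega> by auto
      qed (use \<omega> in auto)
    qed
    from outer_measure_of_Un_le[OF this _ _ elim] show ?case
      using \<open>0 < \<epsilon>\<close> by simp
  qed
  then show "\<exists>C>0. \<forall>\<^sub>F n in sequentially.
      outer_measure_of M {\<omega> \<in> space M. C * s n \<omega> < \<bar>Z n \<omega>\<bar>} \<le> ennreal \<epsilon>"
    using C(1) D(1) by (intro exI[of _ "C * D"]) simp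
qed

context logistic_sample begin

text \<open>The common core of (a) and (b). The penalty may lose a linear term of order
  \<open>r\<close> and a quadratic term whose coefficient can be made as small as desired, off sets
  of vanishing outer measure. In (a) these sets are empty; in (b) they are where the curvature of
  the penalty is large.\<close>

lemma penalized_rate:
  fixes betahat :: "nat \<Rightarrow> 'w \<Rightarrow> real^'p" and pen :: "nat \<Rightarrow> 'w \<Rightarrow> real^'p \<Rightarrow> real"
  assumes minimal: "\<And>n \<omega>. 1 \<le> n \<Longrightarrow> \<omega> \<in> space M \<Longrightarrow>
      emp_loss n \<omega> (betahat n \<omega>) + pen n \<omega> (betahat n \<omega>) \<le> emp_loss n \<omega> \<beta>\<^sub>0 + pen n \<omega> \<beta>\<^sub>0"
    and consistent: "converges_in_probability M betahat \<beta>\<^sub>0"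
    and r_nonneg: "\<And>n \<omega>. 1 \<le> n \<Longrightarrow> \<omega> \<in> space M \<Longrightarrow> 0 \<le> r n \<omega>"
    and penalty: "\<And>c. 0 < c \<Longrightarrow> \<exists>\<delta>>0. \<exists>K\<ge>0. \<exists>Bad. (\<forall>n. Bad n \<subseteq> space M) \<and>
      (\<lambda>n. outer_measure_of M (Bad n)) \<longlonglongrightarrow> 0 \<and>
      (\<forall>n\<ge>1. \<forall>\<omega>\<in>space M - Bad n. \<forall>\<beta>. norm (\<beta> - \<beta>\<^sub>0) \<le> \<delta> \<longrightarrow>
        pen n \<omega> \<beta>\<^sub>0 - pen n \<omega> \<beta> \<le> K * r n \<omega> * norm (\<beta> - \<beta>\<^sub>0) + c * (norm (\<beta> - \<beta>\<^sub>0))\<^sup>2)"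
  shows "bigO_in_probability M (\<lambda>n \<omega>. norm (betahat n \<omega> - \<beta>\<^sub>0)) (\<lambda>n \<omega>. r n \<omega> + 1 / sqrt (real n))"
  unfolding bigO_in_probability_def
proof (intro allI impI)
  fix \<epsilon> :: real assume "0 < \<epsilon>"
  then have \<epsilon>3: "0 < \<epsilon> / 3"
    by simp
  obtain c where c: "0 < c" "\<forall>\<epsilon>>0. \<exists>\<eta>>0. \<exists>C>0. \<forall>\<^sub>F n in sequentially. \<exists>E\<in>events. prob E \<le> \<epsilon> \<and>
    (\<forall>\<omega>\<in>space M - E. \<forall>\<beta>. norm (\<beta> - \<beta>\<^sub>0) \<le> \<eta> \<longrightarrow>
      c * (norm (\<beta> - \<beta>\<^sub>0))\<^sup>2 - C / sqrt (real n) * norm (\<beta> - \<beta>\<^sub>0)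
        \<le> emp_loss n \<omega> \<beta> - emp_loss n \<omega> \<beta>\<^sub>0)"
    using quadratic_lower_bound by blast
  obtain \<eta> C where \<eta>: "0 < \<eta>" "0 < C" and lower:
    "\<forall>\<^sub>F n in sequentially. \<exists>E\<in>events. prob E \<le> \<epsilon> / 3 \<and>
    (\<forall>\<omega>\<in>space M - E. \<forall>\<beta>. norm (\<beta> - \<beta>\<^sub>0) \<le> \<eta> \<longrightarrow>
      c * (norm (\<beta> - \<beta>\<^sub>0))\<^sup>2 - C / sqrt (real n) * norm (\<beta> - \<beta>\<^sub>0)
        \<le> emp_loss n \<omega> \<beta> - emp_loss n \<omega> \<beta>\<^sub>0)"
    using c(2) \<epsilon>3 by blast
  \<comment> \<open>The penalty may use up half of the curvature of the loss; the other half yields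
    the rate.\<close>
  obtain \<delta> K Bad where \<delta>: "0 < \<delta>" "0 \<le> K" and Bad_space: "\<And>n. Bad n \<subseteq> space M"
    and Bad_lim: "(\<lambda>n. outer_measure_of M (Bad n)) \<longlonglongrightarrow> 0"
    and pen: "\<And>n \<omega> \<beta>. 1 \<le> n \<Longrightarrow> \<omega> \<in> space M - Bad n \<Longrightarrow> norm (\<beta> - \<beta>\<^sub>0) \<le> \<delta> \<Longrightarrow>
        pen n \<omega> \<beta>\<^sub>0 - pen n \<omega> \<beta> \<le> K * r n \<omega> * norm (\<beta> - \<beta>\<^sub>0) + c / 2 * (norm (\<beta> - \<beta>\<^sub>0))\<^sup>2"
    using penalty[OF half_gt_zero[OF c(1)]] by blast
  define \<theta> where "\<theta> = min \<eta> \<delta>"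
  have "0 < \<theta>"
    using \<eta> \<delta> by (simp add: \<theta>_def)
  define Far where "Far n = {\<omega> \<in> space M. ennreal \<theta> < ennreal (dist (betahat n \<omega>) \<beta>\<^sub>0)}" for n
  have "(\<lambda>n. outer_measure_of M (Far n)) \<longlonglongrightarrow> 0"
    using consistent \<open>0 < \<theta>\<close>
    unfolding converges_in_probability_def vanishes_in_probability_def Far_def by blast
  then have Far: "\<forall>\<^sub>F n in sequentially. outer_measure_of M (Far n) \<le> ennreal (\<epsilon> / 3)"
    using \<epsilon>3 by (rule eventually_le_ennreal)
  have Bad: "\<forall>\<^sub>F n in sequentially. outer_measure_of M (Bad n) \<le> ennreal (\<epsilon> / 3)"
    using Bad_lim \<epsilon>3 by (rule eventually_le_ennreal)
  \<comment> \<open>The constant left after division of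
    \<open>c / 2 * \<Delta>\<^sup>2 \<le> (C + K) * (r + u) * \<Delta>\<close> by
    \<open>c / 2 * \<Delta>\<close>.\<close>
  define D where "D = 2 / c * (C + K)"
  have "0 < D"
    using c(1) \<eta>(2) \<delta>(2) by (simp add: D_def)
  moreover have "\<forall>\<^sub>F n in sequentially. outer_measure_of M
      {\<omega> \<in> space M. D * (r n \<omega> + 1 / sqrt (real n)) < \<bar>norm (betahat n \<omega> - \<beta>\<^sub>0)\<bar>} \<le> ennreal \<epsilon>"
    using lower Far Bad eventually_ge_at_top[of 1]
  proof eventually_elim
    case (elim n)
    then obtain E where E: "E \<in> events" "prob E \<le> \<epsilon> / 3"
      and low: "\<And>\<omega> \<beta>. \<omega> \<in> space M - E \<Longrightarrow> norm (\<beta> - \<beta>\<^sub>0) \<le> \<eta> \<Longrightarrow>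
        c * (norm (\<beta> - \<beta>\<^sub>0))\<^sup>2 - C / sqrt (real n) * norm (\<beta> - \<beta>\<^sub>0)
          \<le> emp_loss n \<omega> \<beta> - emp_loss n \<omega> \<beta>\<^sub>0"
      by blast
    have "{\<omega> \<in> space M. D * (r n \<omega> + 1 / sqrt (real n)) < \<bar>norm (betahat n \<omega> - \<beta>\<^sub>0)\<bar>}
        \<subseteq> E \<union> (Far n \<union> Bad n)"
    proof (rule subsetI, rule ccontr)
      fix \<omega>
      assume \<omega>: "\<omega> \<in> {\<omega> \<in> space M. D * (r n \<omega> + 1 / sqrt (real n)) < \<bar>norm (betahat n \<omega> - \<beta>\<^sub>0)\<bar>}"
        and notin: "\<omega> \<notin> E \<union> (Far n \<union> Bad n)"
      define \<Delta> where "\<Delta> = norm (betahat n \<omega> - \<beta>\<^sub>0)"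
      define u where "u = 1 / sqrt (real n)"
      have "\<Delta> \<le> \<theta>"
        using \<omega> notin \<open>0 < \<theta>\<close> by (auto simp: Far_def \<Delta>_def dist_norm ennreal_less_iff)
      then have "\<Delta> \<le> \<eta>" "\<Delta> \<le> \<delta>"
        by (simp_all add: \<theta>_def)
      have r: "0 \<le> r n \<omega>" and u: "0 \<le> u"
        using \<omega> r_nonneg elim by (auto simp: u_def)
      have "c * \<Delta>\<^sup>2 - C * u * \<Delta> \<le> K * r n \<omega> * \<Delta> + c / 2 * \<Delta>\<^sup>2"
        using low[of \<omega> "betahat n \<omega>"] pen[of n \<omega> "betahat n \<omega>"] minimal[of n \<omega>]
          \<open>\<Delta> \<le> \<eta>\<close> \<open>\<Delta> \<le> \<delta>\<close> \<omega> notin elim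
        unfolding \<Delta>_def u_def by auto
      then have "c / 2 * \<Delta> * \<Delta> \<le> (C * u + K * r n \<omega>) * \<Delta>"
        by (simp add: algebra_simps power2_eq_square)
      \<comment> \<open>The cross terms added here are non-negative; they put both sources of error
        under one constant.\<close>
      also have "\<dots> \<le> (C + K) * (r n \<omega> + u) * \<Delta>"
        using r u \<eta>(2) \<delta>(2) by (intro mult_right_mono) (auto simp: algebra_simps \<Delta>_def)
      \<comment> \<open>Division by \<Delta> needs it to be non-zero; an estimator equal to
        \<open>\<beta>\<^sub>0\<close> satisfies the bound trivially.\<close>
      finally have "c / 2 * \<Delta> \<le> (C + K) * (r n \<omega> + u)" if "\<Delta> \<noteq> 0"
        by (rule mult_right_le_imp_le) (use that in \<open>simp add: \<Delta>_def\<close>)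
      moreover have "0 \<le> (C + K) * (r n \<omega> + u)"
        using r u \<eta>(2) \<delta>(2) by simp
      ultimately have "c / 2 * \<Delta> \<le> (C + K) * (r n \<omega> + u)"
        by (cases "\<Delta> = 0") auto
      then have "\<Delta> \<le> D * (r n \<omega> + u)"
        using c(1) by (simp add: D_def field_simps)
      then show False
        using \<omega> by (simp add: \<Delta>_def u_def)
    qed
    moreover have "outer_measure_of M (Far n \<union> Bad n) \<le> ennreal (\<epsilon> / 3 + \<epsilon> / 3)"
      by (rule outer_measure_of_Un_le[OF order_refl _ _ elim(2,3)])
        (use \<epsilon>3 Bad_space in \<open>auto simp: Far_def\<close>)
    moreover have "outer_measure_of M E \<le> ennreal (\<epsilon> / 3)"
      using E \<epsilon>3 by (simp add: emeasure_eq_measure ennreal_leI)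
    moreover have "E \<subseteq> space M" "Far n \<union> Bad n \<subseteq> space M"
      using sets.sets_into_space[OF E(1)] Bad_space by (auto simp: Far_def)
    ultimately have "outer_measure_of M
        {\<omega> \<in> space M. D * (r n \<omega> + 1 / sqrt (real n)) < \<bar>norm (betahat n \<omega> - \<beta>\<^sub>0)\<bar>}
        \<le> ennreal (\<epsilon> / 3 + (\<epsilon> / 3 + \<epsilon> / 3))"
      using outer_measure_of_Un_le[of _ E "Far n \<union> Bad n" M "\<epsilon> / 3" "\<epsilon> / 3 + \<epsilon> / 3"] \<epsilon>3
        add_nonneg_nonneg[of "\<epsilon> / 3" "\<epsilon> / 3"] less_imp_le[OF \<epsilon>3] by blast
    then show ?case
      by simp
  qed
  ultimately show "\<exists>C>0. \<forall>\<^sub>F n in sequentially. outer_measure_of M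
      {\<omega> \<in> space M. C * (r n \<omega> + 1 / sqrt (real n)) < \<bar>norm (betahat n \<omega> - \<beta>\<^sub>0)\<bar>} \<le> ennreal \<epsilon>"
    by blast
qed

end

section \<open>Decrease of a separable penalty near the true parameter\<close>

lemma max_slope_nonneg:
  assumes "\<And>l. \<beta> $ l \<noteq> 0 \<Longrightarrow> 0 \<le> J' \<bar>\<beta> $ l\<bar>"
  shows "0 \<le> max_slope J' \<beta>"
proof (cases "\<beta> = 0")
  case False
  then obtain l where l: "\<beta> $ l \<noteq> 0"
    by (auto simp: vec_eq_iff)
  have "0 \<le> J' \<bar>\<beta> $ l\<bar>"
    using l by (rule assms)
  also have "\<dots> \<le> max_slope J' \<beta>"
    using l False by (auto simp: max_slope_def)
  finally show ?thesis .
qed (simp add: max_slope_def)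

lemma le_max_slope: "J' \<bar>\<beta> $ l\<bar> \<le> max_slope J' \<beta>" if "\<beta> $ l \<noteq> 0"
  using that by (auto simp: max_slope_def)

text \<open>Coordinates where \<open>\<beta>\<^sub>0\<close> vanishes can only raise the penalty,
  because \<open>J 0 = 0\<close> and \<open>J\<close> is non-negative; so a kink of \<open>J\<close>
  at 0 does no harm. The remaining coordinates stay away from 0 and admit a second-order
  expansion.\<close>

lemma separable_penalty_bound:
  fixes \<beta>\<^sub>0 \<beta> :: "real^'p"
  assumes J: "\<And>t. 0 < t \<Longrightarrow> (J has_real_derivative J' t) (at t)"
    and J': "\<And>t. 0 < t \<Longrightarrow> (J' has_real_derivative J'' t) (at t)"
    and J_nonneg: "\<And>t. 0 \<le> t \<Longrightarrow> 0 \<le> J t" and J_0: "J 0 = 0"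
    and slope: "\<And>l. \<beta>\<^sub>0 $ l \<noteq> 0 \<Longrightarrow> 0 \<le> J' \<bar>\<beta>\<^sub>0 $ l\<bar>"
    and \<delta>: "0 < \<delta>" "\<And>l. \<beta>\<^sub>0 $ l \<noteq> 0 \<Longrightarrow> \<delta> < \<bar>\<beta>\<^sub>0 $ l\<bar>"
    and curvature: "sup_curvature J'' \<beta>\<^sub>0 \<delta> \<le> ennreal \<kappa>" and "0 \<le> \<kappa>"
    and near: "norm (\<beta> - \<beta>\<^sub>0) \<le> \<delta>"
  shows "(\<Sum>l\<in>UNIV. J \<bar>\<beta>\<^sub>0 $ l\<bar>) - (\<Sum>l\<in>UNIV. J \<bar>\<beta> $ l\<bar>)
    \<le> real CARD('p) * max_slope J' \<beta>\<^sub>0 * norm (\<beta> - \<beta>\<^sub>0) + \<kappa> / 2 * (norm (\<beta> - \<beta>\<^sub>0))\<^sup>2"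
proof -
  define a where "a = max_slope J' \<beta>\<^sub>0"
  have "0 \<le> a"
    unfolding a_def using slope by (rule max_slope_nonneg)
  have coord: "J \<bar>\<beta>\<^sub>0 $ l\<bar> - J \<bar>\<beta> $ l\<bar> \<le> a * norm (\<beta> - \<beta>\<^sub>0) + \<kappa> / 2 * ((\<beta> - \<beta>\<^sub>0) $ l)\<^sup>2" for l
  proof (cases "\<beta>\<^sub>0 $ l = 0")
    case True
    have "0 \<le> J \<bar>\<beta> $ l\<bar>" "0 \<le> a * norm (\<beta> - \<beta>\<^sub>0) + \<kappa> / 2 * ((\<beta> - \<beta>\<^sub>0) $ l)\<^sup>2"
      using J_nonneg \<open>0 \<le> a\<close> \<open>0 \<le> \<kappa>\<close> by simp_all
    then show ?thesis
      using True J_0 by simp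
  next
    case False
    define b where "b = \<bar>\<beta>\<^sub>0 $ l\<bar>"
    define t where "t = \<bar>\<beta> $ l\<bar>"
    have h: "\<bar>(\<beta> - \<beta>\<^sub>0) $ l\<bar> \<le> norm (\<beta> - \<beta>\<^sub>0)"
      by (rule component_le_norm_cart)
    have tb: "\<bar>t - b\<bar> \<le> \<bar>(\<beta> - \<beta>\<^sub>0) $ l\<bar>"
      by (simp add: t_def b_def)
    have "\<delta> < b"
      unfolding b_def using False by (rule \<delta>)
    then have "0 < min t b"
      using tb h near \<delta>(1) by simp
    then obtain \<xi> where \<xi>: "\<bar>\<xi> - b\<bar> \<le> \<bar>t - b\<bar>" "J t = J b + J' b * (t - b) + J'' \<xi> / 2 * (t - b)\<^sup>2"
      using Taylor_quadratic[of t b J J' J''] J J' by (metis order_less_le_trans)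
    \<comment> \<open>Rescaling exhibits \<xi> as one of the points over which
      \<open>sup_curvature\<close> takes its supremum.\<close>
    define \<tau> where "\<tau> = (\<xi> - b) / \<delta>"
    have "\<bar>\<xi> - b\<bar> \<le> \<delta>"
      using \<xi>(1) tb h near by linarith
    then have \<tau>: "\<tau> \<in> {-1..1}" "\<bar>\<beta>\<^sub>0 $ l\<bar> + \<tau> * \<delta> = \<xi>"
      using \<delta>(1) by (auto simp: \<tau>_def b_def field_simps abs_le_iff)
    have "ennreal \<bar>J'' (\<bar>\<beta>\<^sub>0 $ l\<bar> + \<tau> * \<delta>)\<bar> \<le> sup_curvature J'' \<beta>\<^sub>0 \<delta>"
      unfolding sup_curvature_def using False \<tau>(1) by (intro SUP_upper2[of l] SUP_upper) auto
    then have "ennreal \<bar>J'' \<xi>\<bar> \<le> ennreal \<kappa>"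
      unfolding \<tau>(2) using curvature by (rule order_trans)
    then have "\<bar>J'' \<xi>\<bar> \<le> \<kappa>"
      using \<open>0 \<le> \<kappa>\<close> by (simp add: ennreal_le_iff)
    then have "\<bar>J'' \<xi>\<bar> * (t - b)\<^sup>2 \<le> \<kappa> * ((\<beta> - \<beta>\<^sub>0) $ l)\<^sup>2"
      using power_mono[OF tb abs_ge_zero, of 2] \<open>0 \<le> \<kappa>\<close> by (intro mult_mono) simp_all
    then have 1: "- (J'' \<xi> * (t - b)\<^sup>2) \<le> \<kappa> * ((\<beta> - \<beta>\<^sub>0) $ l)\<^sup>2"
      using mult_right_mono[OF abs_ge_minus_self, of "(t - b)\<^sup>2" "J'' \<xi>"] by simp
    \<comment> \<open>\<open>max_slope\<close> is a maximum of signed slopes; the sign condition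
      makes it a bound on their absolute values.\<close>
    have "0 \<le> J' b" "J' b \<le> a"
      unfolding a_def b_def using False by (auto intro: slope le_max_slope)
    then have "\<bar>J' b * (t - b)\<bar> \<le> a * norm (\<beta> - \<beta>\<^sub>0)"
      unfolding abs_mult using tb h by (intro mult_mono) auto
    then show ?thesis
      using \<xi>(2) 1 unfolding t_def[symmetric] b_def[symmetric] by (simp add: algebra_simps abs_le_iff)
  qed
  have "(\<Sum>l\<in>UNIV. J \<bar>\<beta>\<^sub>0 $ l\<bar>) - (\<Sum>l\<in>UNIV. J \<bar>\<beta> $ l\<bar>)
      \<le> (\<Sum>l\<in>UNIV. a * norm (\<beta> - \<beta>\<^sub>0) + \<kappa> / 2 * ((\<beta> - \<beta>\<^sub>0) $ l)\<^sup>2)"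
    unfolding sum_subtractf[symmetric] by (intro sum_mono coord)
  also have "\<dots> = real CARD('p) * a * norm (\<beta> - \<beta>\<^sub>0) + \<kappa> / 2 * (\<Sum>l\<in>UNIV. ((\<beta> - \<beta>\<^sub>0) $ l)\<^sup>2)"
    by (simp add: sum.distrib sum_distrib_left)
  also have "(\<Sum>l\<in>UNIV. ((\<beta> - \<beta>\<^sub>0) $ l)\<^sup>2) = (norm (\<beta> - \<beta>\<^sub>0))\<^sup>2"
    by (simp add: norm_vec_def L2_set_def sum_nonneg)
  finally show ?thesis
    by (simp add: a_def)
qed

theorem theorem4p2:
  fixes M :: "'w measure"
    and y :: "'w \<Rightarrow> real" and x :: "'w \<Rightarrow> real^'p"
    and ys :: "nat \<Rightarrow> 'w \<Rightarrow> real" and xs :: "nat \<Rightarrow> 'w \<Rightarrow> real^'p"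
    and \<beta>\<^sub>0 :: "real^'p"
    and \<rho> \<psi> \<psi>' :: "real \<Rightarrow> real"
    and w :: "real^'p \<Rightarrow> real"
    and I :: "real \<Rightarrow> real^'p \<Rightarrow> real"
    and lam :: "nat \<Rightarrow> 'w \<Rightarrow> real"
    and betahat :: "nat \<Rightarrow> 'w \<Rightarrow> real^'p"
  assumes prob: "prob_space M"
    and y_meas: "y \<in> borel_measurable M" and x_meas: "x \<in> borel_measurable M"
    and y_01: "\<And>\<omega>. \<omega> \<in> space M \<Longrightarrow> y \<omega> \<in> {0, 1}"
    and model: "AE \<omega> in M.
        real_cond_exp M (vimage_algebra (space M) x borel) (indicat_real {\<omega> \<in> space M. y \<omega> = 1}) \<omega>
          = logistic_cdf (x \<omega> \<bullet> \<beta>\<^sub>0)"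
    and ys_01: "\<And>i \<omega>. i \<ge> 1 \<Longrightarrow> \<omega> \<in> space M \<Longrightarrow> ys i \<omega> \<in> {0, 1}"
    and indep: "prob_space.indep_vars M (\<lambda>_. borel) (\<lambda>i \<omega>. (ys i \<omega>, xs i \<omega>)) {1..}"
    and ident: "\<And>i. i \<ge> 1 \<Longrightarrow>
        distr M borel (\<lambda>\<omega>. (ys i \<omega>, xs i \<omega>)) = distr M borel (\<lambda>\<omega>. (y \<omega>, x \<omega>))"
    and rho_bounded: "bounded (\<rho> ` {0..})"
    and rho_mono: "mono_on {0..} \<rho>"
    and rho_deriv: "\<And>t. t \<ge> 0 \<Longrightarrow> (\<rho> has_real_derivative \<psi> t) (at t within {0..})"
    and R3_deriv: "\<And>t. t \<ge> 0 \<Longrightarrow> (\<psi> has_real_derivative \<psi>' t) (at t within {0..})"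
    and R3_cont: "continuous_on {0..} \<psi>'"
    and R3_bounded: "bounded (\<psi> ` {0..})" "bounded (\<psi>' ` {0..})"
    and w_meas: "w \<in> borel_measurable borel"
    and w_nonneg: "\<And>v. w v \<ge> 0"
    and H2_bounded: "bounded (range w)"
    and H2_norm: "(SUP v. \<bar>w v\<bar>) = 1"
    and H2_support: "measure M {\<omega> \<in> space M. w (x \<omega>) > 0} > 0"
    and H3: "integrable M (\<lambda>\<omega>. w (x \<omega>) * (norm (x \<omega>))\<^sup>2)"
    and H4: "invertible (hessian_A M \<psi> w \<beta>\<^sub>0 x)"
    and penalty_nonneg: "\<And>\<mu> \<beta>. \<mu> > 0 \<Longrightarrow> I \<mu> \<beta> \<ge> 0"
    and lam_meas: "\<And>n. n \<ge> 1 \<Longrightarrow> lam n \<in> borel_measurable M"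
    and lam_pos: "\<And>n \<omega>. n \<ge> 1 \<Longrightarrow> \<omega> \<in> space M \<Longrightarrow> lam n \<omega> > 0"
    and betahat_meas: "\<And>n. n \<ge> 1 \<Longrightarrow> betahat n \<in> borel_measurable M"
    and betahat_argmin: "\<And>n \<omega>. n \<ge> 1 \<Longrightarrow> \<omega> \<in> space M \<Longrightarrow>
        is_arg_min
          (\<lambda>\<beta>. empirical_loss \<rho> \<psi> w (\<lambda>i. ys i \<omega>) (\<lambda>i. xs i \<omega>) n \<beta> + I (lam n \<omega>) \<beta>)
          (\<lambda>_. True) (betahat n \<omega>)"
    and consistent: "converges_in_probability M betahat \<beta>\<^sub>0"
  shows
   "((\<exists>\<epsilon>>0. \<exists>K. \<forall>\<mu>>0. \<forall>\<beta>\<^sub>1 \<beta>\<^sub>2. norm (\<beta>\<^sub>1 - \<beta>\<^sub>0) \<le> \<epsilon> \<longrightarrow> norm (\<beta>\<^sub>2 - \<beta>\<^sub>0) \<le> \<epsilon> \<longrightarrow>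
         \<bar>I \<mu> \<beta>\<^sub>1 - I \<mu> \<beta>\<^sub>2\<bar> \<le> \<mu> * K * (\<Sum>l\<in>UNIV. \<bar>(\<beta>\<^sub>1 - \<beta>\<^sub>2) $ l\<bar>))
      \<longrightarrow>
       bigO_in_probability M (\<lambda>n \<omega>. norm (betahat n \<omega> - \<beta>\<^sub>0)) (\<lambda>n \<omega>. lam n \<omega> + 1 / sqrt (real n))
     \<and> (bigO_in_probability M lam (\<lambda>n \<omega>. 1 / sqrt (real n)) \<longrightarrow>
          bigO_in_probability M (\<lambda>n \<omega>. norm (betahat n \<omega> - \<beta>\<^sub>0)) (\<lambda>n \<omega>. 1 / sqrt (real n)))
     \<and> (diverges_in_probability M (\<lambda>n \<omega>. lam n \<omega> * sqrt (real n)) \<longrightarrow>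
          bigO_in_probability M (\<lambda>n \<omega>. norm (betahat n \<omega> - \<beta>\<^sub>0)) lam))
    \<and>
    (\<forall>J J' J'' :: real \<Rightarrow> real \<Rightarrow> real.
       (\<forall>n\<ge>1. \<forall>\<omega>\<in>space M.
          (\<forall>\<beta>. I (lam n \<omega>) \<beta> = (\<Sum>l\<in>UNIV. J (lam n \<omega>) \<bar>\<beta> $ l\<bar>)) \<and>
          (\<forall>t>0. (J (lam n \<omega>) has_real_derivative J' (lam n \<omega>) t) (at t)) \<and>
          (\<forall>t>0. (J' (lam n \<omega>) has_real_derivative J'' (lam n \<omega>) t) (at t)) \<and>
          (\<forall>t\<ge>0. J (lam n \<omega>) t \<ge> 0) \<and>
          J (lam n \<omega>) 0 = 0 \<and>
          (\<forall>l. \<beta>\<^sub>0 $ l \<noteq> 0 \<longrightarrow> J' (lam n \<omega>) \<bar>\<beta>\<^sub>0 $ l\<bar> \<ge> 0)) \<and>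
       (\<exists>\<delta>>0. (\<forall>l. \<beta>\<^sub>0 $ l \<noteq> 0 \<longrightarrow> \<delta> < \<bar>\<beta>\<^sub>0 $ l\<bar>) \<and>
          vanishes_in_probability M (\<lambda>n \<omega>. sup_curvature (J'' (lam n \<omega>)) \<beta>\<^sub>0 \<delta>))
      \<longrightarrow>
       bigO_in_probability M (\<lambda>n \<omega>. norm (betahat n \<omega> - \<beta>\<^sub>0))
         (\<lambda>n \<omega>. 1 / sqrt (real n) + max_slope (J' (lam n \<omega>)) \<beta>\<^sub>0))"
proof -
  have Pair_meas: "(\<lambda>\<omega>. (y \<omega>, x \<omega>)) \<in> borel_measurable M"
    using y_meas x_meas by measurable
  have w_le_1: "w v \<le> 1" for v
  proof -
    \<comment> \<open>Boundedness of \<open>w\<close> is needed first: the real supremum is an upper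
      bound only of a set that is bounded above.\<close>
    have "bdd_above (range (\<lambda>v. \<bar>w v\<bar>))"
      using H2_bounded by (auto simp: bounded_iff bdd_above_def)
    then have "\<bar>w v\<bar> \<le> (SUP v. \<bar>w v\<bar>)"
      by (intro cSUP_upper) auto
    then show ?thesis
      using H2_norm by simp
  qed
  interpret prob_space M
    by (rule prob)
  interpret logistic_sample \<rho> \<psi> \<psi>' M y x ys xs \<beta>\<^sub>0 w
    by unfold_locales
      (fact rho_mono rho_deriv R3_deriv R3_cont R3_bounded Pair_meas indep ident y_01 model ys_01
        w_meas w_nonneg w_le_1 H3 H4)+
  have minimal: "emp_loss n \<omega> (betahat n \<omega>) + I (lam n \<omega>) (betahat n \<omega>)
      \<le> emp_loss n \<omega> \<beta>\<^sub>0 + I (lam n \<omega>) \<beta>\<^sub>0" if "1 \<le> n" "\<omega> \<in> space M" for n \<omega>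
    using betahat_argmin[OF that] unfolding is_arg_min_linorder emp_loss_def by simp
  have rate_a: "bigO_in_probability M (\<lambda>n \<omega>. norm (betahat n \<omega> - \<beta>\<^sub>0))
      (\<lambda>n \<omega>. lam n \<omega> + 1 / sqrt (real n))"
    if \<epsilon>: "0 < \<epsilon>" and Lip: "\<forall>\<mu>>0. \<forall>\<beta>\<^sub>1 \<beta>\<^sub>2. norm (\<beta>\<^sub>1 - \<beta>\<^sub>0) \<le> \<epsilon> \<longrightarrow> norm (\<beta>\<^sub>2 - \<beta>\<^sub>0) \<le> \<epsilon> \<longrightarrow>
         \<bar>I \<mu> \<beta>\<^sub>1 - I \<mu> \<beta>\<^sub>2\<bar> \<le> \<mu> * K * (\<Sum>l\<in>UNIV. \<bar>(\<beta>\<^sub>1 - \<beta>\<^sub>2) $ l\<bar>)" for \<epsilon> K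
  proof (rule penalized_rate[where pen = "\<lambda>n \<omega>. I (lam n \<omega>)", OF minimal consistent])
    show "0 \<le> lam n \<omega>" if "1 \<le> n" "\<omega> \<in> space M" for n \<omega>
      using lam_pos[OF that] by simp
    fix c :: real assume c: "0 < c"
    \<comment> \<open>The dimension comes from comparing the l1 norm with the Euclidean norm
      coordinate by coordinate; the absolute value is taken because \<open>K\<close> is given
      without a sign.\<close>
    have "I (lam n \<omega>) \<beta>\<^sub>0 - I (lam n \<omega>) \<beta>
        \<le> (\<bar>K\<bar> * real CARD('p)) * lam n \<omega> * norm (\<beta> - \<beta>\<^sub>0) + c * (norm (\<beta> - \<beta>\<^sub>0))\<^sup>2"
      if "1 \<le> n" "\<omega> \<in> space M" "norm (\<beta> - \<beta>\<^sub>0) \<le> \<epsilon>" for n \<omega> \<beta>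
    proof -
      have pos: "0 < lam n \<omega>"
        using lam_pos that by blast
      have "I (lam n \<omega>) \<beta>\<^sub>0 - I (lam n \<omega>) \<beta> \<le> lam n \<omega> * K * (\<Sum>l\<in>UNIV. \<bar>(\<beta> - \<beta>\<^sub>0) $ l\<bar>)"
        using Lip pos that(3) \<epsilon> abs_le_D2[of "I (lam n \<omega>) \<beta> - I (lam n \<omega>) \<beta>\<^sub>0"] by force
      also have "\<dots> \<le> lam n \<omega> * \<bar>K\<bar> * (\<Sum>l\<in>UNIV. \<bar>(\<beta> - \<beta>\<^sub>0) $ l\<bar>)"
        using pos by (intro mult_right_mono mult_left_mono sum_nonneg) auto
      also have "\<dots> \<le> lam n \<omega> * \<bar>K\<bar> * (\<Sum>l\<in>(UNIV :: 'p set). norm (\<beta> - \<beta>\<^sub>0))"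
        using pos by (intro mult_left_mono sum_mono component_le_norm_cart) auto
      also have "\<dots> \<le> (\<bar>K\<bar> * real CARD('p)) * lam n \<omega> * norm (\<beta> - \<beta>\<^sub>0) + c * (norm (\<beta> - \<beta>\<^sub>0))\<^sup>2"
        using c by (simp add: algebra_simps)
      finally show ?thesis .
    qed
    then show "\<exists>\<delta>>0. \<exists>K\<ge>0. \<exists>Bad. (\<forall>n. Bad n \<subseteq> space M) \<and>
      (\<lambda>n. outer_measure_of M (Bad n)) \<longlonglongrightarrow> 0 \<and>
      (\<forall>n\<ge>1. \<forall>\<omega>\<in>space M - Bad n. \<forall>\<beta>. norm (\<beta> - \<beta>\<^sub>0) \<le> \<delta> \<longrightarrow>
        I (lam n \<omega>) \<beta>\<^sub>0 - I (lam n \<omega>) \<beta>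
          \<le> K * lam n \<omega> * norm (\<beta> - \<beta>\<^sub>0) + c * (norm (\<beta> - \<beta>\<^sub>0))\<^sup>2)"
      using \<epsilon>
      by (intro exI[of _ \<epsilon>] exI[of _ "\<bar>K\<bar> * real CARD('p)"] exI[of _ "\<lambda>_. {}"] conjI) auto
  qed
  have rate_a1: "bigO_in_probability M (\<lambda>n \<omega>. norm (betahat n \<omega> - \<beta>\<^sub>0)) (\<lambda>n \<omega>. 1 / sqrt (real n))"
    if a: "bigO_in_probability M (\<lambda>n \<omega>. norm (betahat n \<omega> - \<beta>\<^sub>0)) (\<lambda>n \<omega>. lam n \<omega> + 1 / sqrt (real n))"
      and b: "bigO_in_probability M lam (\<lambda>n \<omega>. 1 / sqrt (real n))"
  proof (rule bigO_in_probability_trans[OF a])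
    fix \<epsilon> :: real assume "0 < \<epsilon>"
    then obtain C where C: "0 < C" "\<forall>\<^sub>F n in sequentially.
        outer_measure_of M {\<omega> \<in> space M. C * (1 / sqrt (real n)) < \<bar>lam n \<omega>\<bar>} \<le> ennreal \<epsilon>"
      using b unfolding bigO_in_probability_def by blast
    \<comment> \<open>Where \<open>lam\<close> is at most \<open>C / sqrt n\<close>, adding
      \<open>1 / sqrt n\<close> raises the constant by 1.\<close>
    have "\<forall>\<^sub>F n in sequentially. outer_measure_of M
        {\<omega> \<in> space M. (C + 1) * (1 / sqrt (real n)) < lam n \<omega> + 1 / sqrt (real n)} \<le> ennreal \<epsilon>"
      using C(2)
      by eventually_elim (rule order_trans[OF outer_measure_of_mono], auto simp: distrib_right add_divide_distrib)
    then show "\<exists>D>0. \<forall>\<^sub>F n in sequentially. outer_measure_of M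
        {\<omega> \<in> space M. D * (1 / sqrt (real n)) < lam n \<omega> + 1 / sqrt (real n)} \<le> ennreal \<epsilon>"
      using C(1) by (intro exI[of _ "C + 1"]) simp
  qed
  have rate_a2: "bigO_in_probability M (\<lambda>n \<omega>. norm (betahat n \<omega> - \<beta>\<^sub>0)) lam"
    if a: "bigO_in_probability M (\<lambda>n \<omega>. norm (betahat n \<omega> - \<beta>\<^sub>0)) (\<lambda>n \<omega>. lam n \<omega> + 1 / sqrt (real n))"
      and b: "diverges_in_probability M (\<lambda>n \<omega>. lam n \<omega> * sqrt (real n))"
  proof (rule bigO_in_probability_trans[OF a])
    fix \<epsilon> :: real assume "0 < \<epsilon>"
    \<comment> \<open>Level 1 of the divergence suffices: where \<open>lam * sqrt n > 1\<close>, the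
      term \<open>1 / sqrt n\<close> is below \<open>lam\<close> and the sum is below
      \<open>2 * lam\<close>.\<close>
    then have "\<forall>\<^sub>F n in sequentially.
        outer_measure_of M {\<omega> \<in> space M. lam n \<omega> * sqrt (real n) \<le> 1} \<le> ennreal \<epsilon>"
      using b unfolding diverges_in_probability_def by (intro eventually_le_ennreal) blast
    then have "\<forall>\<^sub>F n in sequentially. outer_measure_of M
        {\<omega> \<in> space M. 2 * lam n \<omega> < lam n \<omega> + 1 / sqrt (real n)} \<le> ennreal \<epsilon>"
      using eventually_ge_at_top[of 1]
      by eventually_elim (rule order_trans[OF outer_measure_of_mono], auto simp: field_simps)
    then show "\<exists>D>0. \<forall>\<^sub>F n in sequentially. outer_measure_of M
        {\<omega> \<in> space M. D * lam n \<omega> < lam n \<omega> + 1 / sqrt (real n)} \<le> ennreal \<epsilon>"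
      by (intro exI[of _ 2]) simp
  qed
  have rate_b: "bigO_in_probability M (\<lambda>n \<omega>. norm (betahat n \<omega> - \<beta>\<^sub>0))
      (\<lambda>n \<omega>. max_slope (J' (lam n \<omega>)) \<beta>\<^sub>0 + 1 / sqrt (real n))"
    if J: "\<And>n \<omega>. 1 \<le> n \<Longrightarrow> \<omega> \<in> space M \<Longrightarrow>
          (\<forall>\<beta>. I (lam n \<omega>) \<beta> = (\<Sum>l\<in>UNIV. J (lam n \<omega>) \<bar>\<beta> $ l\<bar>)) \<and>
          (\<forall>t>0. (J (lam n \<omega>) has_real_derivative J' (lam n \<omega>) t) (at t)) \<and>
          (\<forall>t>0. (J' (lam n \<omega>) has_real_derivative J'' (lam n \<omega>) t) (at t)) \<and>
          (\<forall>t\<ge>0. J (lam n \<omega>) t \<ge> 0) \<and>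
          J (lam n \<omega>) 0 = 0 \<and>
          (\<forall>l. \<beta>\<^sub>0 $ l \<noteq> 0 \<longrightarrow> J' (lam n \<omega>) \<bar>\<beta>\<^sub>0 $ l\<bar> \<ge> 0)"
      and \<delta>: "0 < \<delta>" "\<And>l. \<beta>\<^sub>0 $ l \<noteq> 0 \<Longrightarrow> \<delta> < \<bar>\<beta>\<^sub>0 $ l\<bar>"
      and curvature: "vanishes_in_probability M (\<lambda>n \<omega>. sup_curvature (J'' (lam n \<omega>)) \<beta>\<^sub>0 \<delta>)"
    for J J' J'' :: "real \<Rightarrow> real \<Rightarrow> real" and \<delta>
  proof (rule penalized_rate[where pen = "\<lambda>n \<omega>. I (lam n \<omega>)", OF minimal consistent])
    show "0 \<le> max_slope (J' (lam n \<omega>)) \<beta>\<^sub>0" if "1 \<le> n" "\<omega> \<in> space M" for n \<omega>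
      using J[OF that] by (intro max_slope_nonneg) blast
    fix c :: real assume c: "0 < c"
    \<comment> \<open>The level is \<open>2 * c\<close> because Taylor's formula halves the second
      derivative.\<close>
    define Bad where "Bad n = {\<omega> \<in> space M. ennreal (2 * c) < sup_curvature (J'' (lam n \<omega>)) \<beta>\<^sub>0 \<delta>}" for n
    have "(\<lambda>n. outer_measure_of M (Bad n)) \<longlonglongrightarrow> 0"
      using curvature c unfolding vanishes_in_probability_def Bad_def by simp
    moreover have "I (lam n \<omega>) \<beta>\<^sub>0 - I (lam n \<omega>) \<beta> \<le> real CARD('p) * max_slope (J' (lam n \<omega>)) \<beta>\<^sub>0
        * norm (\<beta> - \<beta>\<^sub>0) + c * (norm (\<beta> - \<beta>\<^sub>0))\<^sup>2"
      if "1 \<le> n" "\<omega> \<in> space M - Bad n" "norm (\<beta> - \<beta>\<^sub>0) \<le> \<delta>" for n \<omega> \<beta>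
    proof -
      have "\<omega> \<in> space M" and curv: "sup_curvature (J'' (lam n \<omega>)) \<beta>\<^sub>0 \<delta> \<le> ennreal (2 * c)"
        using that by (auto simp: Bad_def not_less)
      note Jn = J[OF that(1) this(1)]
      have "(\<Sum>l\<in>UNIV. J (lam n \<omega>) \<bar>\<beta>\<^sub>0 $ l\<bar>) - (\<Sum>l\<in>UNIV. J (lam n \<omega>) \<bar>\<beta> $ l\<bar>)
        \<le> real CARD('p) * max_slope (J' (lam n \<omega>)) \<beta>\<^sub>0 * norm (\<beta> - \<beta>\<^sub>0)
          + 2 * c / 2 * (norm (\<beta> - \<beta>\<^sub>0))\<^sup>2"
        by (rule separable_penalty_bound[OF _ _ _ _ _ \<delta> curv _ that(3)]) (use Jn c in auto)
      then show ?thesis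
        using Jn by simp
    qed
    ultimately show "\<exists>\<delta>>0. \<exists>K\<ge>0. \<exists>Bad. (\<forall>n. Bad n \<subseteq> space M) \<and>
      (\<lambda>n. outer_measure_of M (Bad n)) \<longlonglongrightarrow> 0 \<and>
      (\<forall>n\<ge>1. \<forall>\<omega>\<in>space M - Bad n. \<forall>\<beta>. norm (\<beta> - \<beta>\<^sub>0) \<le> \<delta> \<longrightarrow>
        I (lam n \<omega>) \<beta>\<^sub>0 - I (lam n \<omega>) \<beta>
          \<le> K * max_slope (J' (lam n \<omega>)) \<beta>\<^sub>0 * norm (\<beta> - \<beta>\<^sub>0) + c * (norm (\<beta> - \<beta>\<^sub>0))\<^sup>2)"
      using \<delta>(1)
      by (intro exI[of _ \<delta>] exI[of _ "real CARD('p)"] exI[of _ Bad] conjI) (auto simp: Bad_def)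
  qed
  show ?thesis
  proof (intro conjI allI impI; elim exE conjE)
    fix \<epsilon> K
    assume "0 < \<epsilon>" "\<forall>\<mu>>0. \<forall>\<beta>\<^sub>1 \<beta>\<^sub>2. norm (\<beta>\<^sub>1 - \<beta>\<^sub>0) \<le> \<epsilon> \<longrightarrow> norm (\<beta>\<^sub>2 - \<beta>\<^sub>0) \<le> \<epsilon> \<longrightarrow>
         \<bar>I \<mu> \<beta>\<^sub>1 - I \<mu> \<beta>\<^sub>2\<bar> \<le> \<mu> * K * (\<Sum>l\<in>UNIV. \<bar>(\<beta>\<^sub>1 - \<beta>\<^sub>2) $ l\<bar>)"
    note a = rate_a[OF this]
    show "bigO_in_probability M (\<lambda>n \<omega>. norm (betahat n \<omega> - \<beta>\<^sub>0)) (\<lambda>n \<omega>. lam n \<omega> + 1 / sqrt (real n))"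
      by (rule a)
    show "bigO_in_probability M (\<lambda>n \<omega>. norm (betahat n \<omega> - \<beta>\<^sub>0)) (\<lambda>n \<omega>. 1 / sqrt (real n))"
      if "bigO_in_probability M lam (\<lambda>n \<omega>. 1 / sqrt (real n))"
      using a that by (rule rate_a1)
    show "bigO_in_probability M (\<lambda>n \<omega>. norm (betahat n \<omega> - \<beta>\<^sub>0)) lam"
      if "diverges_in_probability M (\<lambda>n \<omega>. lam n \<omega> * sqrt (real n))"
      using a that by (rule rate_a2)
  next
    fix J J' J'' :: "real \<Rightarrow> real \<Rightarrow> real" and \<delta>
    assume "0 < \<delta>" "\<forall>l. \<beta>\<^sub>0 $ l \<noteq> 0 \<longrightarrow> \<delta> < \<bar>\<beta>\<^sub>0 $ l\<bar>"
      "vanishes_in_probability M (\<lambda>n \<omega>. sup_curvature (J'' (lam n \<omega>)) \<beta>\<^sub>0 \<delta>)"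
      "\<forall>n\<ge>1. \<forall>\<omega>\<in>space M.
          (\<forall>\<beta>. I (lam n \<omega>) \<beta> = (\<Sum>l\<in>UNIV. J (lam n \<omega>) \<bar>\<beta> $ l\<bar>)) \<and>
          (\<forall>t>0. (J (lam n \<omega>) has_real_derivative J' (lam n \<omega>) t) (at t)) \<and>
          (\<forall>t>0. (J' (lam n \<omega>) has_real_derivative J'' (lam n \<omega>) t) (at t)) \<and>
          (\<forall>t\<ge>0. J (lam n \<omega>) t \<ge> 0) \<and>
          J (lam n \<omega>) 0 = 0 \<and>
          (\<forall>l. \<beta>\<^sub>0 $ l \<noteq> 0 \<longrightarrow> J' (lam n \<omega>) \<bar>\<beta>\<^sub>0 $ l\<bar> \<ge> 0)"
    then show "bigO_in_probability M (\<lambda>n \<omega>. norm (betahat n \<omega> - \<beta>\<^sub>0))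
         (\<lambda>n \<omega>. 1 / sqrt (real n) + max_slope (J' (lam n \<omega>)) \<beta>\<^sub>0)"
      using rate_b[of J J' J'' \<delta>] by (simp add: add.commute)
  qed
qed

end
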